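(* Let $J \in \mathbb{N}$ with $J \geq 3$. Let $(X, \mathcal{F}, \mu, T)$ be an invertible probability measure-preserving system, and for every $j \in [J]$ let $a_j \in \mathbb{Z}$, where $a_1,\dots,a_J$ are distinct and all nonzero. Then there exist constants $C_J > 0$ and $N_J \in \mathbb{N}$ such that for all $f_1, \ldots, f_J \in L^\infty(\mu)$ with $\max_{j \in [J]}\|f_j\|_\infty \leq 1$, and for every $N \in \mathbb{N}$ with $N \geq N_J$, we have $$\left\| \frac{1}{N} \sum_{n=1}^N \prod_{j=1}^J f_j \circ T^{a_jn} \right\|_{1} \leq C_J\left( \frac{1}{\lfloor \sqrt{N}\rfloor^{1/2^{J-2}}} + \left(\frac{1}{\lfloor\sqrt{N}\rfloor^{J-2}} \sum_{h \in [\lfloor\sqrt{N}\rfloor]^{J-2}}\left\| \sup_{t\in\mathbb{R}} \left| \frac{1}{N} \sum_{n=1}^N e^{2\pi i n t} \left[ \prod_{\eta \in V_{J-2}} c^{|\eta|} f_1 \circ T^{h \cdot \eta}\right]\circ T^n\right|\right\|_1^{2/3} \right)^{1/2^{J-2}} \right).$$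
   Context: A system $(X,\mathcal{F},\mu,T)$ is a probability space with a measure-preserving map $T$; $\|\cdot\|_p$ is the $L^p(\mu)$-norm. For $M\in\mathbb{N}$, $[M]=\{1,\dots,M\}$. For $k\in\mathbb{N}$, $V_k=\{0,1\}^k$; for $\eta\in V_k$, $|\eta|=\sum_{j=1}^k\eta_j$; for $h\in[M]^k$, $h\cdot\eta=\sum_{j=1}^k h_j\eta_j$. The symbol $c$ denotes complex conjugation, so $c^{|\eta|}g=g$ if $|\eta|$ is even and $c^{|\eta|}g=\overline{g}$ if $|\eta|$ is odd. *)

theory Defs
  imports "HOL-Probability.Probability"
begin

definition measure_preserving_map :: "'a measure \<Rightarrow> ('a \<Rightarrow> 'a) \<Rightarrow> bool" where
  "measure_preserving_map M T \<longleftrightarrow>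
     T \<in> measurable M M \<and> (\<forall>A\<in>sets M. emeasure M (T -` A \<inter> space M) = emeasure M A)"

(* The inverse automatically preserves the measure, so only its measurability is required. *)
definition invertible_system :: "'a measure \<Rightarrow> ('a \<Rightarrow> 'a) \<Rightarrow> bool" where
  "invertible_system M T \<longleftrightarrow>
     prob_space M \<and> measure_preserving_map M T \<and>
     bij_betw T (space M) (space M) \<and> inv_into (space M) T \<in> measurable M M"

(* T^k for an integer k; the inverse is the one on space M, because T need not be
   injective on the whole type. *)
definition int_iter :: "'a measure \<Rightarrow> ('a \<Rightarrow> 'a) \<Rightarrow> int \<Rightarrow> 'a \<Rightarrow> 'a" where
  "int_iter M T k = (if 0 \<le> k then T ^^ nat k else inv_into (space M) T ^^ nat (- k))"

definition Linf_norm :: "'a measure \<Rightarrow> ('a \<Rightarrow> complex) \<Rightarrow> ereal" where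
  "Linf_norm M f = esssup M (\<lambda>x. ereal (norm (f x)))"

definition Linf :: "'a measure \<Rightarrow> ('a \<Rightarrow> complex) set" where
  "Linf M = {f \<in> borel_measurable M. Linf_norm M f < \<infinity>}"

(* The Bochner integral is 0 on non-integrable functions, so this is the norm only on L^1;
   it is used for essentially bounded measurable functions on a probability space. *)
definition L1_norm :: "'a measure \<Rightarrow> ('a \<Rightarrow> 'b::real_normed_vector) \<Rightarrow> real" where
  "L1_norm M f = (\<integral>x. norm (f x) \<partial>M)"

(* Vectors indexed by [k] are extensional functions on {1..k}. *)
definition nat_box :: "nat \<Rightarrow> nat \<Rightarrow> (nat \<Rightarrow> nat) set" where
  "nat_box M k = {1..k} \<rightarrow>\<^sub>E {1..M}"

definition cube :: "nat \<Rightarrow> (nat \<Rightarrow> nat) set" where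
  "cube k = {1..k} \<rightarrow>\<^sub>E {0, 1}"

definition cube_size :: "nat \<Rightarrow> (nat \<Rightarrow> nat) \<Rightarrow> nat" where
  "cube_size k \<eta> = (\<Sum>j=1..k. \<eta> j)"

definition dot :: "nat \<Rightarrow> (nat \<Rightarrow> nat) \<Rightarrow> (nat \<Rightarrow> nat) \<Rightarrow> nat" where
  "dot k h \<eta> = (\<Sum>j=1..k. h j * \<eta> j)"

definition cube_product ::
    "('a \<Rightarrow> 'a) \<Rightarrow> nat \<Rightarrow> (nat \<Rightarrow> nat) \<Rightarrow> ('a \<Rightarrow> complex) \<Rightarrow> 'a \<Rightarrow> complex" where
  "cube_product T k h f x =
     (\<Prod>\<eta>\<in>cube k. (cnj ^^ cube_size k \<eta>) (f ((T ^^ dot k h \<eta>) x)))"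

definition multiple_average ::
    "'a measure \<Rightarrow> ('a \<Rightarrow> 'a) \<Rightarrow> nat \<Rightarrow> (nat \<Rightarrow> int) \<Rightarrow> (nat \<Rightarrow> 'a \<Rightarrow> complex) \<Rightarrow> nat \<Rightarrow> 'a \<Rightarrow> complex" where
  "multiple_average M T J a f N x =
     (1 / of_nat N) * (\<Sum>n=1..N. \<Prod>j=1..J. f j (int_iter M T (a j * int n) x))"

(* The family over t is bounded above by the average of the absolute values of g along
   the orbit, so this conditional supremum is a genuine one at every point. *)
definition sup_twisted_average ::
    "('a \<Rightarrow> 'a) \<Rightarrow> ('a \<Rightarrow> complex) \<Rightarrow> nat \<Rightarrow> 'a \<Rightarrow> real" where
  "sup_twisted_average T g N x =
     (SUP t::real. norm ((1 / of_nat N) *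
        (\<Sum>n=1..N. exp (2 * of_real pi * \<i> * of_nat n * of_real t) * g ((T ^^ n) x))))"

definition isqrt :: "nat \<Rightarrow> nat" where
  "isqrt N = nat \<lfloor>sqrt (real N)\<rfloor>"

end

theory Submission
  imports Defs
begin

text \<open>
  Induction on the number of functions, for functions bounded by 1 and with the sign of
  \<open>a\<^sub>1\<close> normalised by the substitution \<open>n \<mapsto> N + 1 - n\<close>. One van der Corput step with
  parameter \<open>K = \<lfloor>\<surd>N\<rfloor> div a\<^sub>1\<close>, followed by composition with \<open>T\<close> to the power
  \<open>- a\<^sub>J n\<close>, removes the last function, replaces \<open>a\<^sub>j\<close> by \<open>a\<^sub>j - a\<^sub>J\<close> and \<open>f\<^sub>1\<close> by \<open>f\<^sub>1\<close> times
  the conjugate of \<open>f\<^sub>1\<close> shifted by \<open>a\<^sub>1 d\<close>; the shifts \<open>a\<^sub>1 d\<close> are among those up to \<open>\<lfloor>\<surd>N\<rfloor>\<close>, so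
  completing the sum over them costs only a constant.

  For two functions, averaging the point over the shifts \<open>b m\<close> with \<open>b = a\<^sub>2\<close> and \<open>m \<le> L\<close> turns the
  average along an orbit into a trilinear form in the linear pattern
  \<open>(m, l, (b - a\<^sub>1) m + a\<^sub>1 l)\<close> where \<open>l = m + n\<close>, up to a relative error \<open>L / N\<close> from
  the boundary. Fourier analysis bounds the form by the
  supremum of the Fourier transform of \<open>f\<^sub>1\<close> times two \<open>\<ell>\<^sup>2\<close> norms. With \<open>s\<close> the norm of the supremum this gives
  \<open>L / N + (N / L)\<^sup>1\<^sup>/\<^sup>2 s\<close>, and \<open>L \<approx> s\<^sup>2\<^sup>/\<^sup>3 N\<close> explains the exponent \<open>2/3\<close>.
\<close>

subsection \<open>Fourier analysis of a trilinear form\<close>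

definition cis2 :: "real \<Rightarrow> complex" where
  "cis2 t = cis (2 * pi * t)"

lemma norm_cis2 [simp]: "norm (cis2 t) = 1"
  and cis2_add: "cis2 (s + t) = cis2 s * cis2 t"
  and cnj_cis2: "cnj (cis2 t) = cis2 (- t)"
  and cis2_0 [simp]: "cis2 0 = 1"
  by (auto simp: cis2_def cis_mult cis_cnj algebra_simps)

lemma exp_eq_cis2: "exp (2 * of_real pi * \<i> * of_nat n * of_real t) = cis2 (real n * t)"
  by (simp add: cis2_def cis_conv_exp mult_ac)

text \<open>Orthogonality of the characters of the integers modulo \<open>P\<close>: a geometric sum
  with ratio \<open>z \<noteq> 1\<close> and \<open>z ^ P = 1\<close>. Because \<open>k\<close> is
  smaller than \<open>P\<close> in size, divisibility by \<open>P\<close> forces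
  \<open>k = 0\<close>.\<close>

lemma sum_cis2_eq:
  assumes "P > 0" "\<bar>k\<bar> < int P"
  shows "(\<Sum>j<P. cis2 (real j * (real_of_int k / real P))) = (if k = 0 then of_nat P else 0)"
proof (cases "k = 0")
  case False
  define z where "z = cis2 (real_of_int k / real P)"
  have pow: "cis2 (real j * (real_of_int k / real P)) = z ^ j" for j
    by (simp only: z_def cis2_def Complex.DeMoivre mult.left_commute)
  have "z \<noteq> 1"
  proof
    assume "z = 1"
    then have "cos (2 * pi * (real_of_int k / real P)) = 1"
      by (auto simp: z_def cis2_def complex_eq_iff)
    then obtain i :: int where "2 * pi * (real_of_int k / real P) = of_int i * 2 * pi"
      using cos_one_2pi_int by auto
    then have "real_of_int k = real_of_int (i * int P)"
      using assms by (simp add: field_simps)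
    then have "k = i * int P" by linarith
    with assms False show False by (auto simp: abs_mult)
  qed
  moreover have "z ^ P = 1"
    using assms by (simp flip: pow add: cis2_def cis_multiple_2pi)
  ultimately have "(\<Sum>j<P. z ^ j) = 0"
    by (simp add: geometric_sum)
  then show ?thesis using False by (simp only: pow if_False)
qed simp

text \<open>Expanding the square and using orthogonality leaves only the diagonal. Taking
  \<open>P\<close> beyond all differences of frequencies rules out coincidences modulo
  \<open>P\<close>, and \<open>c \<noteq> 0\<close> keeps the frequencies \<open>c * m\<close>
  distinct.\<close>

lemma parseval:
  fixes u :: "int \<Rightarrow> complex"
  assumes "finite A" "P > 0" "c \<noteq> 0" "\<And>m m'. m \<in> A \<Longrightarrow> m' \<in> A \<Longrightarrow> \<bar>c * (m - m')\<bar> < int P"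
  shows "(\<Sum>j<P. (norm (\<Sum>m\<in>A. u m * cis2 (real j * (real_of_int (c * m) / real P))))\<^sup>2)
      = real P * (\<Sum>m\<in>A. (norm (u m))\<^sup>2)"
proof -
  define e where "e j k = cis2 (real j * (real_of_int k / real P))" for j k
  have "complex_of_real (\<Sum>j<P. (norm (\<Sum>m\<in>A. u m * e j (c * m)))\<^sup>2)
      = (\<Sum>j<P. \<Sum>m\<in>A. \<Sum>m'\<in>A. u m * cnj (u m') * e j (c * (m - m')))"
    unfolding of_real_sum complex_norm_square cnj_sum sum_product
    by (intro sum.cong refl)
      (auto simp: e_def cnj_cis2 simp flip: cis2_add intro!: arg_cong[where f = cis2]
        simp: diff_divide_distrib right_diff_distrib)
  also have "\<dots> = (\<Sum>m\<in>A. \<Sum>m'\<in>A. \<Sum>j<P. u m * cnj (u m') * e j (c * (m - m')))"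
    by (subst sum.swap, rule sum.cong[OF refl], rule sum.swap)
  also have "\<dots> = (\<Sum>m\<in>A. \<Sum>m'\<in>A. if m = m' then u m * cnj (u m') * of_nat P else 0)"
    using assms by (intro sum.cong refl) (simp only: e_def sum_cis2_eq flip: sum_distrib_left, simp)
  also have "\<dots> = (\<Sum>m\<in>A. u m * cnj (u m) * of_nat P)"
    using assms(1) by simp
  also have "\<dots> = complex_of_real (real P * (\<Sum>m\<in>A. (norm (u m))\<^sup>2))"
    unfolding of_real_mult of_real_sum sum_distrib_left complex_norm_square by (simp add: mult_ac)
  finally show ?thesis unfolding of_real_eq_iff e_def .
qed

lemma finite_int_bounded:
  assumes "finite (A :: int set)"
  obtains D where "D \<ge> 0" "\<And>m. m \<in> A \<Longrightarrow> \<bar>m\<bar> \<le> D"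
proof
  show "0 \<le> (\<Sum>m\<in>A. \<bar>m\<bar>)" by (simp add: sum_nonneg)
  show "\<bar>m\<bar> \<le> (\<Sum>m\<in>A. \<bar>m\<bar>)" if "m \<in> A" for m
    using that assms by (intro member_le_sum) auto
qed

text \<open>The relation \<open>k = c * m + d * l\<close> is detected by averaging characters modulo
  a large \<open>P\<close>, which factors the form into transforms of \<open>\<phi>\<close>,
  \<open>u\<close> and \<open>v\<close>. The first is bounded by \<open>B\<close>; Cauchy-Schwarz
  and Parseval handle the other two.\<close>

lemma trilinear_fourier:
  fixes u v \<phi> :: "int \<Rightarrow> complex"
  assumes fin: "finite A" "finite L" "finite K" and cd: "c \<noteq> 0" "d \<noteq> 0"
    and B: "\<And>t. norm (\<Sum>k\<in>K. \<phi> k * cis2 (of_int k * t)) \<le> B"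
  shows "norm (\<Sum>m\<in>A. \<Sum>l\<in>L. u m * v l * (if c * m + d * l \<in> K then \<phi> (c * m + d * l) else 0))
    \<le> B * (sqrt (\<Sum>m\<in>A. (norm (u m))\<^sup>2) * sqrt (\<Sum>l\<in>L. (norm (v l))\<^sup>2))"
proof -
  \<comment> \<open>\<open>R\<close> collects every integer that must vanish as soon as it is
    divisible by \<open>P\<close>. A \<open>P\<close> beyond all of them allows computing in a
    finite cyclic group without wrap-around.\<close>
  define R where "R = (\<lambda>(m, m'). - c * (m - m')) ` (A \<times> A) \<union> (\<lambda>(l, l'). - d * (l - l')) ` (L \<times> L)
      \<union> (\<lambda>(k, m, l). k - c * m - d * l) ` (K \<times> A \<times> L)"
  have "finite R"
    using fin by (simp add: R_def)
  then obtain D where D: "D \<ge> 0" "\<And>m. m \<in> R \<Longrightarrow> \<bar>m\<bar> \<le> D"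
    using finite_int_bounded by blast
  define P where "P = Suc (nat D)"
  have P: "P > 0" "\<bar>m\<bar> < int P" if "m \<in> R" for m
    using D(1) D(2)[OF that] by (auto simp: P_def)
  have P0: "P > 0" by (simp add: P_def)
  have PA: "\<bar>- c * (m - m')\<bar> < int P" if "m \<in> A" "m' \<in> A" for m m'
    using that by (intro P) (force simp: R_def)
  have PL: "\<bar>- d * (l - l')\<bar> < int P" if "l \<in> L" "l' \<in> L" for l l'
    using that by (intro P) (force simp: R_def)
  have PK: "\<bar>k - c * m - d * l\<bar> < int P" if "k \<in> K" "m \<in> A" "l \<in> L" for k m l
    using that by (intro P) (force simp: R_def)
  define e where "e j k = cis2 (real j * (real_of_int k / real P))" for j k
  define F where "F j = (\<Sum>k\<in>K. \<phi> k * e j k)" for j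
  define G where "G j = (\<Sum>m\<in>A. u m * e j (- c * m))" for j
  define H where "H j = (\<Sum>l\<in>L. v l * e j (- d * l))" for j
  have e_add: "e j (k + l) = e j k * e j l" for j k l
    by (simp add: e_def add_divide_distrib distrib_left flip: cis2_add)
  have e_add3: "e j (k - c * m - d * l) = e j k * e j (- c * m) * e j (- d * l)" for j k m l
    by (simp flip: e_add)
  have "(if c * m + d * l \<in> K then \<phi> (c * m + d * l) else 0)
      = (\<Sum>k\<in>K. \<phi> k * (\<Sum>j<P. e j (k - c * m - d * l)) / of_nat P)" if "m \<in> A" "l \<in> L" for m l
  proof -
    have "(\<Sum>j<P. e j (k - c * m - d * l)) = (if k = c * m + d * l then of_nat P else 0)"
      if "k \<in> K" for k
      unfolding e_def sum_cis2_eq[OF P0 PK[OF \<open>k \<in> K\<close> \<open>m \<in> A\<close> \<open>l \<in> L\<close>]] by auto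
    then have "(\<Sum>k\<in>K. \<phi> k * (\<Sum>j<P. e j (k - c * m - d * l)) / of_nat P)
      = (\<Sum>k\<in>K. if k = c * m + d * l then \<phi> k else 0)"
      using P0 by (intro sum.cong) auto
    then show ?thesis using fin by simp
  qed
  then have "(\<Sum>m\<in>A. \<Sum>l\<in>L. u m * v l * (if c * m + d * l \<in> K then \<phi> (c * m + d * l) else 0))
    = (\<Sum>m\<in>A. \<Sum>l\<in>L. u m * v l * (\<Sum>k\<in>K. \<phi> k * (\<Sum>j<P. e j (k - c * m - d * l)) / of_nat P))"
    by (intro sum.cong) auto
  also have "\<dots> = (\<Sum>m\<in>A. \<Sum>l\<in>L. \<Sum>k\<in>K. \<Sum>j<P. (\<phi> k * e j k) * (u m * e j (- c * m)) * (v l * e j (- d * l)) / of_nat P)"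
    unfolding e_add3 sum_distrib_left sum_divide_distrib
    by (intro sum.cong refl) (simp only: times_divide_eq_right times_divide_eq_left mult_ac)
  also have "\<dots> = (\<Sum>m\<in>A. \<Sum>l\<in>L. \<Sum>j<P. \<Sum>k\<in>K. (\<phi> k * e j k) * (u m * e j (- c * m)) * (v l * e j (- d * l)) / of_nat P)"
    by (intro sum.cong refl sum.swap)
  also have "\<dots> = (\<Sum>m\<in>A. \<Sum>j<P. \<Sum>l\<in>L. \<Sum>k\<in>K. (\<phi> k * e j k) * (u m * e j (- c * m)) * (v l * e j (- d * l)) / of_nat P)"
    by (intro sum.cong refl sum.swap)
  also have "\<dots> = (\<Sum>j<P. \<Sum>m\<in>A. \<Sum>l\<in>L. \<Sum>k\<in>K. (\<phi> k * e j k) * (u m * e j (- c * m)) * (v l * e j (- d * l)) / of_nat P)"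
    by (rule sum.swap)
  also have "\<dots> = (\<Sum>j<P. F j * G j * H j / of_nat P)"
    unfolding F_def G_def H_def by (simp only: sum_distrib_left[symmetric] sum_distrib_right[symmetric] sum_divide_distrib[symmetric])
  finally have eq: "(\<Sum>m\<in>A. \<Sum>l\<in>L. u m * v l * (if c * m + d * l \<in> K then \<phi> (c * m + d * l) else 0))
     = (\<Sum>j<P. F j * G j * H j / of_nat P)" .
  have F: "norm (F j) \<le> B" for j
    using B[of "real j / real P"] unfolding F_def e_def by (simp add: mult_ac)
  have "B \<ge> 0" using order_trans[OF norm_ge_zero F] .
  have GG: "(\<Sum>j<P. (norm (G j))\<^sup>2) = real P * (\<Sum>m\<in>A. (norm (u m))\<^sup>2)"
    unfolding G_def e_def using cd fin P0 PA
    by (intro parseval) auto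
  have HH: "(\<Sum>j<P. (norm (H j))\<^sup>2) = real P * (\<Sum>l\<in>L. (norm (v l))\<^sup>2)"
    unfolding H_def e_def using cd fin P0 PL
    by (intro parseval) auto
  \<comment> \<open>Each of the two Parseval identities contributes a factor \<open>sqrt P\<close>;
    together they cancel the normalisation \<open>1 / P\<close>.\<close>
  have "sqrt P * x * (sqrt P * y) = (sqrt P * sqrt P) * (x * y)" for x y :: real
    by (simp only: mult_ac)
  then have sqrtP: "sqrt P * x * (sqrt P * y) = P * (x * y)" for x y :: real
    by simp
  have "norm (\<Sum>j<P. F j * G j * H j / of_nat P) \<le> (\<Sum>j<P. B * norm (G j) * norm (H j) / of_nat P)"
    using F \<open>B \<ge> 0\<close> by (intro sum_norm_le) (auto simp: norm_mult norm_divide intro!: divide_right_mono mult_right_mono)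
  also have "\<dots> = B / P * (\<Sum>j<P. \<bar>norm (G j)\<bar> * \<bar>norm (H j)\<bar>)"
    by (simp add: sum_distrib_left mult_ac)
  also have "\<dots> \<le> B / P * (L2_set (\<lambda>j. norm (G j)) {..<P} * L2_set (\<lambda>j. norm (H j)) {..<P})"
    using \<open>B \<ge> 0\<close> by (intro mult_left_mono L2_set_mult_ineq) auto
  also have "\<dots> = B * (sqrt (\<Sum>m\<in>A. (norm (u m))\<^sup>2) * sqrt (\<Sum>l\<in>L. (norm (v l))\<^sup>2))"
    unfolding L2_set_def GG HH real_sqrt_mult sqrtP using P0 by simp
  finally show ?thesis unfolding eq .
qed

section \<open>From sums along an orbit to the trilinear form\<close>

lemma norm_eq_unimodular_mult:
  fixes z :: complex
  obtains w where "norm w \<le> 1" "w * z = of_real (norm z)"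
proof
  show "norm (cnj (sgn z)) \<le> 1" by (simp add: norm_sgn)
  show "cnj (sgn z) * z = of_real (norm z)"
    by (cases "z = 0")
      (auto simp: sgn_eq complex_cnj_divide mult.commute[of "cnj z"] power2_eq_square
        simp flip: complex_norm_square)
qed

text \<open>With \<open>l = m + n\<close> the arguments become \<open>(b - a) * m + a * l\<close>
  and \<open>b * l\<close>, so \<open>F2\<close> depends on \<open>l\<close> alone. Replacing the
  range of \<open>n\<close> by the condition that the argument of \<open>F1\<close> lies in
  \<open>{1..a * N}\<close> gives the trilinear form, at a cost confined to the boundary.\<close>

lemma bilinear_sequence_bound:
  fixes F1 F2 :: "int \<Rightarrow> complex" and a b M N :: int
  assumes ab: "a > 0" "b \<noteq> 0" "a \<noteq> b" and MN: "1 \<le> M" "M \<le> N"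
    and F: "\<And>k. norm (F1 k) \<le> 1" "\<And>k. norm (F2 k) \<le> 1"
    and B: "\<And>t. norm (\<Sum>k=1..a*N. F1 k * cis2 (of_int k * t)) \<le> B"
  shows "(\<Sum>m=1..M. norm (\<Sum>n=1..N. F1 (b * m + a * n) * F2 (b * (m + n))))
    \<le> 6 * \<bar>real_of_int b\<bar> * (real_of_int M)\<^sup>2 + B * (sqrt M * sqrt (2 * N))"
proof -
  define L where "L = {1..N + M}"
  define K where "K = {1..a * N}"
  define G where "G m l = F1 ((b - a) * m + a * l) * F2 (b * l)" for m l
  define Z where "Z m = (\<Sum>l\<in>L. if (b - a) * m + a * l \<in> K then G m l else 0)" for m
  have G: "norm (G m l) \<le> 1" for m l
    using F by (simp add: G_def norm_mult mult_le_one)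
  have Z: "norm (\<Sum>n=1..N. F1 (b * m + a * n) * F2 (b * (m + n))) \<le> norm (Z m) + 6 * \<bar>b\<bar> * M"
    if m: "m \<in> {1..M}" for m
  proof -
    \<comment> \<open>The shift \<open>b * m\<close> has size at most \<open>D\<close>, so the two
      range conditions can disagree only for \<open>n\<close> within \<open>D\<close> of
      \<open>0\<close> or of \<open>N\<close>. \<open>E\<close> holds the corresponding values of
      \<open>l\<close>.\<close>
    define D where "D = \<bar>b\<bar> * M"
    define E where "E = (\<lambda>n. n + m) ` ({-D..D} \<union> {N-D..N+D})"
    have "\<bar>b * m\<bar> \<le> D"
      unfolding D_def abs_mult using m by (intro mult_left_mono) auto
    then have D: "b * m \<le> D" "- (b * m) \<le> D" by auto
    have D1: "D \<ge> 1" using ab MN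
      by (metis D_def Groups.mult_ac(2) mult_le_cancel_left1 zero_less_abs_iff int_one_le_iff_zero_less mult_pos_pos less_le_trans zero_less_one)
    have le: "x \<le> a * x" if "x \<ge> 0" for x
      using ab that by (simp add: mult_le_cancel_right1)
    have "(\<Sum>n=1..N. F1 (b * m + a * n) * F2 (b * (m + n)))
      = (\<Sum>l\<in>{l \<in> L. l - m \<in> {1..N}}. G m l)"
      using m by (intro sum.reindex_bij_witness[where i = "\<lambda>l. l - m" and j = "\<lambda>n. n + m"])
        (auto simp: L_def G_def algebra_simps)
    also have "\<dots> = (\<Sum>l\<in>L. if l - m \<in> {1..N} then G m l else 0)"
      by (rule sum.inter_filter) (simp add: L_def)
    finally have "norm ((\<Sum>n=1..N. F1 (b * m + a * n) * F2 (b * (m + n))) - Z m)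
      = norm (\<Sum>l\<in>L. (if l - m \<in> {1..N} then G m l else 0) - (if (b - a) * m + a * l \<in> K then G m l else 0))"
      by (simp only: Z_def sum_subtractf)
    also have "\<dots> \<le> (\<Sum>l\<in>L. if l \<in> E then 1 else 0)"
    proof (rule sum_norm_le)
      fix l assume "l \<in> L"
      define n where "n = l - m"
      have k: "(b - a) * m + a * l = b * m + a * n" by (simp add: n_def algebra_simps)
      have "n \<in> {-D..D} \<union> {N-D..N+D}" if ne: "n \<in> {1..N} \<longleftrightarrow> b * m + a * n \<notin> K"
      proof (rule ccontr)
        assume n: "n \<notin> {-D..D} \<union> {N-D..N+D}"
        \<comment> \<open>Since \<open>a \<ge> 1\<close>, a distance greater than \<open>D\<close>
          from \<open>0\<close> or \<open>N\<close> stays greater than \<open>D\<close> after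
          scaling by \<open>a\<close>, so the shift \<open>b * m\<close> cannot carry
          \<open>a * n\<close> across an end of \<open>K\<close>.\<close>
        consider "n < -D" | "D < n" "n < N - D" | "N + D < n"
          using n MN D1 by force
        then show False
        proof cases
          case 1
          then have "a * n \<le> n" using ab D1 by (simp add: mult_le_cancel_right2)
          then have "a * n < - D" using 1 by linarith
          then show False using 1 ne D D1 MN by (auto simp: K_def)
        next
          case 2
          then have "n \<le> a * n" "N - n \<le> a * (N - n)" using D1 ab by (auto intro!: le simp del: mult_le_cancel_left1 mult_le_cancel_right1)
          then have "D < a * n" "D < a * (N - n)" using 2 by linarith+
          then show False using 2 ne D D1 MN by (auto simp: K_def algebra_simps)
        next
          case 3
          then have "n - N \<le> a * (n - N)" using D1 ab by (auto intro!: le simp del: mult_le_cancel_left1 mult_le_cancel_right1)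
          then have "D < a * (n - N)" using 3 by linarith
          then show False using 3 ne D D1 MN by (auto simp: K_def algebra_simps)
        qed
      qed
      then have "l \<in> E" if "l - m \<in> {1..N} \<longleftrightarrow> (b - a) * m + a * l \<notin> K"
        using that unfolding k E_def
        by (intro image_eqI[where x = n]) (auto simp: n_def)
      then show "norm ((if l - m \<in> {1..N} then G m l else 0) - (if (b - a) * m + a * l \<in> K then G m l else 0))
        \<le> (if l \<in> E then 1 else 0)"
        using G[of m l] by auto
    qed
    also have "\<dots> = card (L \<inter> E)"
      by (subst sum.inter_restrict[symmetric]) (auto simp: L_def)
    also have "\<dots> \<le> card E"
      unfolding of_nat_le_iff by (intro card_mono) (auto simp: E_def)
    also have "\<dots> \<le> card ({-D..D} \<union> {N-D..N+D})"
      unfolding of_nat_le_iff E_def by (intro card_image_le) auto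
    also have "\<dots> \<le> card {-D..D} + card {N-D..N+D}"
      unfolding of_nat_le_iff by (rule card_Un_le)
    \<comment> \<open>Both intervals have \<open>2 * D + 1\<close> points, and
      \<open>D \<ge> 1\<close> absorbs the additive constant into \<open>6 * D\<close>.\<close>
    also have "\<dots> = of_int (2 * (2 * D + 1))"
      using D1 by simp
    also have "\<dots> \<le> 6 * \<bar>b\<bar> * M"
      unfolding of_int_le_iff mult.assoc D_def[symmetric] using D1 by simp
    finally show ?thesis
      using norm_triangle_sub[of "\<Sum>n=1..N. F1 (b * m + a * n) * F2 (b * (m + n))" "Z m"] by linarith
  qed
  \<comment> \<open>The weights \<open>w\<close> absorb the phases, so that the sum of norms becomes
    a single trilinear form.\<close>
  have "\<exists>w. norm w \<le> 1 \<and> w * Z m = of_real (norm (Z m))" for m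
    by (metis norm_eq_unimodular_mult)
  then obtain w where w: "\<And>m. norm (w m) \<le> 1" "\<And>m. w m * Z m = of_real (norm (Z m))"
    by metis
  have "(\<Sum>m=1..M. norm (Z m)) = norm (complex_of_real (\<Sum>m=1..M. norm (Z m)))"
    by (simp only: norm_of_real abs_of_nonneg sum_nonneg norm_ge_zero)
  also have "complex_of_real (\<Sum>m=1..M. norm (Z m)) = (\<Sum>m=1..M. w m * Z m)"
    by (simp add: w)
  also have "\<dots> = (\<Sum>m=1..M. \<Sum>l\<in>L. w m * F2 (b * l) *
      (if (b - a) * m + a * l \<in> K then F1 ((b - a) * m + a * l) else 0))"
    unfolding Z_def sum_distrib_left by (intro sum.cong refl) (simp add: G_def mult_ac)
  also have "norm \<dots> \<le> B * (sqrt (\<Sum>m=1..M. (norm (w m))\<^sup>2) * sqrt (\<Sum>l\<in>L. (norm (F2 (b * l)))\<^sup>2))"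
    using ab B by (intro trilinear_fourier) (auto simp: L_def K_def)
  also have "\<dots> \<le> B * (sqrt (\<Sum>m=1..M. 1) * sqrt (\<Sum>l\<in>L. 1))"
    using F w order_trans[OF norm_ge_zero B]
    by (intro mult_left_mono mult_mono real_sqrt_le_mono sum_mono power_le_one) (auto intro: sum_nonneg)
  \<comment> \<open>There are \<open>N + M \<le> 2 * N\<close> values of \<open>l\<close>.\<close>
  also have "\<dots> \<le> B * (sqrt M * sqrt (2 * N))"
    using MN order_trans[OF norm_ge_zero B]
    by (intro mult_left_mono mult_mono real_sqrt_le_mono) (auto simp: L_def)
  finally have main: "(\<Sum>m=1..M. norm (Z m)) \<le> B * (sqrt M * sqrt (2 * N))" .
  have "(\<Sum>m=1..M. norm (\<Sum>n=1..N. F1 (b * m + a * n) * F2 (b * (m + n))))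
      \<le> (\<Sum>m=1..M. norm (Z m) + 6 * \<bar>b\<bar> * M)"
    by (intro sum_mono Z)
  also have "\<dots> = (\<Sum>m=1..M. norm (Z m)) + 6 * \<bar>real_of_int b\<bar> * (real_of_int M)\<^sup>2"
    using MN by (simp add: sum.distrib power2_eq_square)
  finally show ?thesis using main by simp
qed

text \<open>The Fourier sums in the preceding bound have length \<open>a * N\<close>, whereas the
  supremum to be reached involves averages of \<open>N\<close> terms; hence the division into
  blocks.\<close>

lemma norm_sum_blocks_le:
  fixes F :: "nat \<Rightarrow> 'b::real_normed_vector"
  shows "norm (\<Sum>k=1..\<alpha>*N. F k) \<le> (\<Sum>i<\<alpha>. norm (\<Sum>r=1..N. F (i * N + r)))"
proof (induction \<alpha>)
  case (Suc \<alpha>)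
  have "(\<Sum>k=1..Suc \<alpha>*N. F k) = (\<Sum>k=1..\<alpha>*N. F k) + (\<Sum>k=\<alpha>*N+1..\<alpha>*N+N. F k)"
    using sum.ub_add_nat[of 1 "\<alpha>*N" F N] by (simp add: add.commute)
  also have "(\<Sum>k=\<alpha>*N+1..\<alpha>*N+N. F k) = (\<Sum>r=1..N. F (\<alpha> * N + r))"
    using sum.shift_bounds_cl_nat_ivl[of F 1 "\<alpha>*N" N] by (simp add: add.commute)
  finally show ?case
    using Suc norm_triangle_ineq[of "\<Sum>k=1..\<alpha>*N. F k" "\<Sum>r=1..N. F (\<alpha> * N + r)"] by simp
qed simp

subsection \<open>The integer action\<close>

locale invertible_sys =
  fixes M :: "'a measure" and T :: "'a \<Rightarrow> 'a"
  assumes sys: "invertible_system M T"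
begin

sublocale prob_space M
  using sys unfolding invertible_system_def by blast

abbreviation U :: "int \<Rightarrow> 'a \<Rightarrow> 'a" where
  "U \<equiv> int_iter M T"

abbreviation Tinv :: "'a \<Rightarrow> 'a" where
  "Tinv \<equiv> inv_into (space M) T"

lemma T_measurable [measurable]: "T \<in> measurable M M"
  and T_bij: "bij_betw T (space M) (space M)"
  and Tinv_measurable [measurable]: "Tinv \<in> measurable M M"
  using sys unfolding invertible_system_def measure_preserving_map_def by auto

lemma T_Tinv: "x \<in> space M \<Longrightarrow> T (Tinv x) = x"
  and Tinv_T: "x \<in> space M \<Longrightarrow> Tinv (T x) = x"
  using T_bij by (auto simp: bij_betw_inv_into_right bij_betw_inv_into_left)

lemma distr_T: "distr M M T = M"
  by (rule measure_eqI)
    (use sys in \<open>auto simp: invertible_system_def measure_preserving_map_def emeasure_distr\<close>)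

text \<open>As \<open>M\<close> is its own image under \<open>T\<close>, pushing it forward by
  \<open>Tinv\<close> amounts to pushing it forward by \<open>Tinv \<circ> T\<close>, which is the
  identity on \<open>space M\<close>.\<close>

lemma distr_Tinv: "distr M M Tinv = M"
proof -
  have "distr M M Tinv = distr (distr M M T) M Tinv"
    by (simp add: distr_T)
  also have "\<dots> = distr M M (Tinv \<circ> T)"
    by (intro distr_distr) auto
  also have "\<dots> = distr M M (\<lambda>x. x)"
    by (intro distr_cong) (auto simp: Tinv_T)
  finally show ?thesis by (simp add: distr_id2)
qed

lemma distr_funpow:
  assumes [measurable]: "S \<in> measurable M M" and "distr M M S = M"
  shows "distr M M (S ^^ n) = M"
proof (induction n)
  case 0
  then show ?case by (simp add: id_def distr_id2)
next
  case (Suc n)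
  have "distr M M (S ^^ Suc n) = distr (distr M M (S ^^ n)) M S"
    by (subst distr_distr) auto
  also have "\<dots> = M" by (simp only: Suc assms)
  finally show ?case .
qed

lemma U_measurable [measurable]: "U k \<in> measurable M M"
  unfolding int_iter_def by auto

lemma distr_U: "distr M M (U k) = M"
  unfolding int_iter_def by (auto intro!: distr_funpow distr_T distr_Tinv)

lemma U_space: "x \<in> space M \<Longrightarrow> U k x \<in> space M"
  using measurable_space[OF U_measurable] .

lemma U_of_nat: "U (int n) = T ^^ n"
  by (simp add: int_iter_def)

lemma U_0 [simp]: "U 0 x = x"
  by (simp add: int_iter_def)

lemma U_add_1:
  assumes "x \<in> space M"
  shows "U (k + 1) x = T (U k x)"
proof (cases "0 \<le> k")
  case True
  then have "nat (k + 1) = Suc (nat k)" by simp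
  with True show ?thesis by (simp add: int_iter_def)
next
  case False
  \<comment> \<open>For a negative exponent, \<open>T\<close> undoes the outermost of the
    \<open>n + 1\<close> inverse iterates.\<close>
  then obtain n where n: "k = - int (Suc n)"
    by (metis negD not_le)
  have m: "(Tinv ^^ n) x \<in> space M" for n
    using measurable_space[OF measurable_compose_n[OF Tinv_measurable]] assms by blast
  have "U k x = Tinv ((Tinv ^^ n) x)" "U (k + 1) x = (Tinv ^^ n) x"
    unfolding n by (auto simp: int_iter_def nat_add_distrib)
  then show ?thesis by (simp add: T_Tinv m)
qed

lemma U_diff_1:
  assumes "x \<in> space M"
  shows "U (k - 1) x = Tinv (U k x)"
  using U_add_1[OF assms, of "k - 1"] Tinv_T[OF U_space[OF assms]] by simp

text \<open>Induction on \<open>k\<close> upwards and downwards from \<open>0\<close>. The point has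
  to lie in \<open>space M\<close> because \<open>Tinv\<close> is an inverse of \<open>T\<close>
  only there.\<close>

lemma U_add:
  assumes "x \<in> space M"
  shows "U (k + l) x = U k (U l x)"
proof (induction k rule: int_induct[where k = 0])
  case base
  then show ?case by simp
next
  case (step1 i)
  have "U (i + 1 + l) x = U ((i + l) + 1) x" by (simp add: algebra_simps)
  then show ?case using step1 assms by (simp only: U_add_1 U_space)
next
  case (step2 i)
  have "U (i - 1 + l) x = U ((i + l) - 1) x" by (simp add: algebra_simps)
  then show ?case using step2 assms by (simp only: U_diff_1 U_space)
qed

lemma integral_U:
  fixes g :: "'a \<Rightarrow> 'b::{banach, second_countable_topology}"
  assumes "g \<in> borel_measurable M"
  shows "(\<integral>x. g (U k x) \<partial>M) = (\<integral>x. g x \<partial>M)"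
  using integral_distr[OF U_measurable assms, of k] by (simp only: distr_U)

lemma AE_U:
  assumes "AE x in M. P x"
  shows "AE x in M. P (U k x)"
proof -
  from assms have "AE x in distr M M (U k). P x" by (simp only: distr_U)
  then show ?thesis by (rule AE_distrD[OF U_measurable])
qed

lemma L1_norm_U:
  fixes g :: "'a \<Rightarrow> 'b::{banach, second_countable_topology}"
  assumes [measurable]: "g \<in> borel_measurable M"
  shows "L1_norm M (\<lambda>x. g (U k x)) = L1_norm M g"
  unfolding L1_norm_def by (rule integral_U) measurable

lemma integrable_bounded:
  fixes g :: "'a \<Rightarrow> 'b::{banach, second_countable_topology}"
  assumes "g \<in> borel_measurable M" "\<And>x. x \<in> space M \<Longrightarrow> norm (g x) \<le> B"
  shows "integrable M g"
  by (rule integrable_const_bound[where B = B]) (use assms in auto)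

end

subsection \<open>The two-function case\<close>

definition twisted_average :: "('a \<Rightarrow> 'a) \<Rightarrow> ('a \<Rightarrow> complex) \<Rightarrow> nat \<Rightarrow> 'a \<Rightarrow> real \<Rightarrow> complex" where
  "twisted_average T g N x t = (1 / of_nat N) * (\<Sum>n=1..N. cis2 (real n * t) * g ((T ^^ n) x))"

lemma sup_twisted_average_eq:
  "sup_twisted_average T g N x = (SUP t. norm (twisted_average T g N x t))"
  unfolding sup_twisted_average_def twisted_average_def exp_eq_cis2 ..

lemma norm_twisted_average_le:
  "norm (twisted_average T g N x t) \<le> (1 / real N) * (\<Sum>n=1..N. norm (g ((T ^^ n) x)))"
  unfolding twisted_average_def norm_mult
  by (intro mult_mono norm_sum[THEN order_trans] sum_mono)
    (auto simp: norm_mult norm_divide)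

lemma bdd_above_twisted_average: "bdd_above (range (\<lambda>t. norm (twisted_average T g N x t)))"
  using norm_twisted_average_le by (intro bdd_aboveI2)

lemma twisted_average_le_sup: "norm (twisted_average T g N x t) \<le> sup_twisted_average T g N x"
  unfolding sup_twisted_average_eq by (intro cSUP_upper bdd_above_twisted_average) simp

lemma sup_twisted_average_nonneg: "0 \<le> sup_twisted_average T g N x"
  using order_trans[OF norm_ge_zero twisted_average_le_sup] .

lemma sup_twisted_average_le_1:
  assumes "\<And>x. norm (g x) \<le> 1"
  shows "sup_twisted_average T g N x \<le> 1"
  unfolding sup_twisted_average_eq
proof (rule cSUP_least)
  fix t
  have "norm (twisted_average T g N x t) \<le> (1 / real N) * (\<Sum>n=1..N. norm (g ((T ^^ n) x)))"
    by (rule norm_twisted_average_le)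
  also have "\<dots> \<le> (1 / real N) * (\<Sum>n=1..N. 1)"
    using assms by (intro mult_left_mono sum_mono) auto
  also have "\<dots> \<le> 1" by simp
  finally show "norm (twisted_average T g N x t) \<le> 1" .
qed simp

text \<open>This reduction to a countable index set is what makes the supremum measurable.\<close>

lemma sup_twisted_average_rat:
  "sup_twisted_average T g N x = (SUP q\<in>\<rat>. norm (twisted_average T g N x q))"
proof (rule antisym)
  have bdd: "bdd_above ((\<lambda>q. norm (twisted_average T g N x q)) ` \<rat>)"
    by (rule bdd_above_mono[OF bdd_above_twisted_average]) auto
  show "sup_twisted_average T g N x \<le> (SUP q\<in>\<rat>. norm (twisted_average T g N x q))"
    unfolding sup_twisted_average_eq
  proof (rule cSUP_least)
    fix t
    have "continuous_on (closure \<rat>) (\<lambda>t. norm (twisted_average T g N x t))"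
      unfolding twisted_average_def cis2_def cis_conv_exp by (intro continuous_intros)
    then show "norm (twisted_average T g N x t) \<le> (SUP q\<in>\<rat>. norm (twisted_average T g N x q))"
      by (rule continuous_le_on_closure) (auto simp: Rats_closure_real intro: cSUP_upper[OF _ bdd])
  qed simp
  show "(SUP q\<in>\<rat>. norm (twisted_average T g N x q)) \<le> sup_twisted_average T g N x"
    by (intro cSUP_least twisted_average_le_sup) (use Rats_0 in blast)
qed

lemma sup_twisted_average_measurable [measurable]:
  assumes [measurable]: "T \<in> measurable M M" "g \<in> borel_measurable M"
  shows "sup_twisted_average T g N \<in> borel_measurable M"
proof -
  have "(\<lambda>x. SUP q\<in>\<rat>. norm (twisted_average T g N x q)) \<in> borel_measurable M"
  proof (rule borel_measurable_cSUP)
    show "bdd_above ((\<lambda>q. norm (twisted_average T g N x q)) ` \<rat>)" for x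
      by (rule bdd_above_mono[OF bdd_above_twisted_average]) auto
  qed (auto simp: countable_rat twisted_average_def)
  then show ?thesis by (simp flip: sup_twisted_average_rat)
qed

section \<open>Averages of two functions\<close>

context invertible_sys
begin

lemma funpow_space: "x \<in> space M \<Longrightarrow> (T ^^ n) x \<in> space M"
  using U_space[of x "int n"] by (simp add: U_of_nat)

lemma funpow_U: "x \<in> space M \<Longrightarrow> (T ^^ n) (U k x) = U (int n + k) x"
  by (simp add: U_add U_of_nat)

lemma sup_twisted_average_U:
  assumes "x \<in> space M"
  shows "sup_twisted_average T (\<lambda>y. g (U k y)) N x = sup_twisted_average T g N (U k x)"
proof -
  have "U k ((T ^^ n) x) = (T ^^ n) (U k x)" for n
    using assms by (simp add: funpow_U flip: U_of_nat U_add) (simp add: add.commute)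
  then show ?thesis by (simp add: sup_twisted_average_def)
qed

text \<open>Each block of length \<open>N\<close> is, up to a unimodular factor, \<open>N\<close>
  times a twisted average at the point where the block starts. The resulting bound is uniform in
  \<open>t\<close>.\<close>

lemma norm_interval_sum_le:
  assumes x: "x \<in> space M" and N: "N > 0"
  shows "norm (\<Sum>k=1..int (\<alpha> * N). g (U k x) * cis2 (of_int k * t))
    \<le> real N * (\<Sum>i<\<alpha>. sup_twisted_average T g N (U (int (i * N)) x))"
proof -
  have "(\<Sum>k=1..int (\<alpha> * N). g (U k x) * cis2 (of_int k * t))
    = (\<Sum>k=1..\<alpha> * N. g (U (int k) x) * cis2 (real k * t))"
    by (intro sum.reindex_bij_witness[where i = int and j = nat]) (auto simp: le_nat_iff nat_le_iff simp flip: of_nat_mult simp del: of_nat_mult)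
  also have "norm \<dots> \<le> (\<Sum>i<\<alpha>. norm (\<Sum>r=1..N. g (U (int (i * N + r)) x) * cis2 (real (i * N + r) * t)))"
    by (rule norm_sum_blocks_le)
  also have "\<dots> \<le> (\<Sum>i<\<alpha>. real N * sup_twisted_average T g N (U (int (i * N)) x))"
  proof (rule sum_mono)
    fix i
    have "(\<Sum>r=1..N. g (U (int (i * N + r)) x) * cis2 (real (i * N + r) * t))
      = cis2 (real (i * N) * t) * (\<Sum>r=1..N. cis2 (real r * t) * g ((T ^^ r) (U (int (i * N)) x)))"
      unfolding sum_distrib_left using x
      by (intro sum.cong refl) (simp add: funpow_U cis2_add algebra_simps)
    also have "\<dots> = cis2 (real (i * N) * t) * (of_nat N * twisted_average T g N (U (int (i * N)) x) t)"
      using N by (simp add: twisted_average_def)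
    also have "norm \<dots> \<le> real N * sup_twisted_average T g N (U (int (i * N)) x)"
      by (simp add: norm_mult mult_left_mono twisted_average_le_sup)
    finally show "norm (\<Sum>r=1..N. g (U (int (i * N + r)) x) * cis2 (real (i * N + r) * t))
      \<le> real N * sup_twisted_average T g N (U (int (i * N)) x)" .
  qed
  finally show ?thesis by (simp add: sum_distrib_left)
qed

text \<open>Bounds at every point and for every index avoid null sets and range conditions
  throughout the induction; \<open>multiple_average_bound\<close> reduces essentially bounded
  functions to this case.\<close>

definition bounded_family :: "(nat \<Rightarrow> 'a \<Rightarrow> complex) \<Rightarrow> bool" where
  "bounded_family f \<longleftrightarrow> (\<forall>j. f j \<in> borel_measurable M \<and> (\<forall>x. norm (f j x) \<le> 1))"

lemma bounded_familyD:
  assumes "bounded_family f"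
  shows "f j \<in> borel_measurable M" "norm (f j x) \<le> 1"
  using assms by (auto simp: bounded_family_def)

lemma norm_prod_le_1:
  fixes g :: "'b \<Rightarrow> complex"
  assumes "\<And>i. i \<in> I \<Longrightarrow> norm (g i) \<le> 1"
  shows "norm (prod g I) \<le> 1"
  unfolding prod_norm[symmetric] using assms by (intro prod_le_1) auto

lemma multiple_average_measurable:
  assumes "\<And>j. j \<in> {1..J} \<Longrightarrow> f j \<in> borel_measurable M"
  shows "multiple_average M T J a f N \<in> borel_measurable M"
  unfolding multiple_average_def using assms
  by (intro borel_measurable_times borel_measurable_const borel_measurable_sum borel_measurable_prod
      measurable_compose[OF U_measurable])

lemma norm_multiple_average_le_1:
  assumes "bounded_family f"
  shows "norm (multiple_average M T J a f N x) \<le> 1"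
proof -
  have "norm (\<Sum>n=1..N. \<Prod>j=1..J. f j (U (a j * int n) x)) \<le> (\<Sum>n=1..N. 1)"
    using bounded_familyD[OF assms] by (intro sum_norm_le norm_prod_le_1)
  then show ?thesis
    by (cases "N = 0") (auto simp: multiple_average_def norm_mult norm_divide)
qed

lemma L1_norm_le_1:
  fixes g :: "'a \<Rightarrow> 'b::{banach, second_countable_topology}"
  assumes "\<And>x. norm (g x) \<le> 1"
  shows "L1_norm M g \<le> 1"
proof (cases "integrable M (\<lambda>x. norm (g x))")
  case True
  then have "(\<integral>x. norm (g x) \<partial>M) \<le> (\<integral>x. 1 \<partial>M)"
    using assms by (intro integral_mono) auto
  then show ?thesis by (simp add: L1_norm_def prob_space)
qed (simp add: L1_norm_def not_integrable_integral_eq)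

lemma L1_norm_nonneg: "0 \<le> L1_norm M g"
  unfolding L1_norm_def by simp

text \<open>By invariance the norm is also the mean, over \<open>m \<le> L\<close>, of the norms of
  the translates by \<open>U (a 2 * m)\<close>. The bilinear bound applies on each orbit, and
  integration makes all translates of the supremum contribute equally.\<close>

lemma bilinear_average_bound:
  assumes f: "bounded_family f" and a: "a 1 > 0" "a 2 \<noteq> 0" "a 1 \<noteq> a 2"
    and L: "1 \<le> L" "L \<le> N"
  shows "L1_norm M (multiple_average M T 2 a f N)
    \<le> 6 * \<bar>real_of_int (a 2)\<bar> * (real L / real N) + 2 * real_of_int (a 1) * (sqrt (real N / real L) * L1_norm M (sup_twisted_average T (f 1) N))"
proof -
  note fD = bounded_familyD[OF f]
  let ?A = "multiple_average M T 2 a f N"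
  let ?S = "sup_twisted_average T (f 1) N"
  have [measurable]: "f j \<in> borel_measurable M" for j by (rule fD)
  have [measurable]: "?A \<in> borel_measurable M" "?S \<in> borel_measurable M"
    by (auto intro: multiple_average_measurable)
  define \<alpha> where "\<alpha> = nat (a 1)"
  have \<alpha>: "a 1 = int \<alpha>" using a by (simp add: \<alpha>_def)
  have N: "N > 0" using L by simp
  \<comment> \<open>\<open>B\<close> dominates the Fourier sums of \<open>f 1\<close> along the
    orbit of \<open>x\<close> for all frequencies at once.\<close>
  define B where "B x = real N * (\<Sum>i<\<alpha>. ?S (U (int (i * N)) x))" for x
  have pt: "(\<Sum>m=1..int L. norm (of_nat N * ?A (U (a 2 * m) x)))
      \<le> 6 * \<bar>real_of_int (a 2)\<bar> * real L ^ 2 + B x * (sqrt L * sqrt (2 * N))" if x: "x \<in> space M" for x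
  proof -
    have "of_nat N * ?A (U (a 2 * m) x) = (\<Sum>n=1..int N. f 1 (U (a 2 * m + a 1 * n) x) * f 2 (U (a 2 * (m + n)) x))" for m
    proof -
      have "of_nat N * ?A (U (a 2 * m) x) = (\<Sum>n=1..N. f 1 (U (a 1 * int n) (U (a 2 * m) x)) * f 2 (U (a 2 * int n) (U (a 2 * m) x)))"
        using N by (simp add: multiple_average_def numeral_2_eq_2)
      also have "\<dots> = (\<Sum>n=1..N. f 1 (U (a 2 * m + a 1 * int n) x) * f 2 (U (a 2 * (m + int n)) x))"
        using x by (simp add: algebra_simps flip: U_add)
      also have "\<dots> = (\<Sum>n=1..int N. f 1 (U (a 2 * m + a 1 * n) x) * f 2 (U (a 2 * (m + n)) x))"
        by (intro sum.reindex_bij_witness[where i = nat and j = int]) auto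
      finally show ?thesis .
    qed
    moreover have "(\<Sum>m=1..int L. norm (\<Sum>n=1..int N. f 1 (U (a 2 * m + a 1 * n) x) * f 2 (U (a 2 * (m + n)) x)))
      \<le> 6 * \<bar>real_of_int (a 2)\<bar> * (real_of_int (int L))\<^sup>2 + B x * (sqrt (int L) * sqrt (2 * int N))"
      using a L fD norm_interval_sum_le[OF x N, where g = "f 1" and \<alpha> = \<alpha>]
      by (intro bilinear_sequence_bound) (auto simp: B_def \<alpha>[simplified])
    ultimately show ?thesis by simp
  qed
  have intA: "integrable M (\<lambda>x. norm (of_nat N * ?A (U k x)))" for k
    using norm_multiple_average_le_1[OF f, of 2 a N]
    by (intro integrable_bounded[where B = N]) (auto simp: norm_mult mult_left_le)
  have S1: "?S x \<le> 1" for x using fD by (intro sup_twisted_average_le_1)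
  have intS: "integrable M (\<lambda>x. ?S (U k x))" for k
    using S1 sup_twisted_average_nonneg[of T "f 1" N] by (intro integrable_bounded[where B = 1]) auto
  then have intB: "integrable M B"
    unfolding B_def by auto
  have S: "(\<integral>x. ?S (U k x) \<partial>M) = L1_norm M ?S" for k
    using integral_U[of ?S] sup_twisted_average_nonneg[of T "f 1" N] by (simp add: L1_norm_def)
  have A: "(\<integral>x. norm (of_nat N * ?A (U k x)) \<partial>M) = N * L1_norm M ?A" for k
    using L1_norm_U[of ?A k] by (simp add: norm_mult L1_norm_def)
  have "(\<integral>x. (\<Sum>m=1..int L. norm (of_nat N * ?A (U (a 2 * m) x))) \<partial>M)
     \<le> (\<integral>x. 6 * \<bar>real_of_int (a 2)\<bar> * real L ^ 2 + B x * (sqrt L * sqrt (2 * N)) \<partial>M)"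
    using intA intB pt by (intro integral_mono) auto
  also have "\<dots> = 6 * \<bar>real_of_int (a 2)\<bar> * real L ^ 2 + (\<integral>x. B x \<partial>M) * (sqrt L * sqrt (2 * N))"
    using intB by (simp add: prob_space)
  also have "(\<integral>x. B x \<partial>M) = N * (real_of_int (a 1) * L1_norm M ?S)"
    using intS by (simp add: B_def S \<alpha> del: One_nat_def)
  also have "(\<integral>x. (\<Sum>m=1..int L. norm (of_nat N * ?A (U (a 2 * m) x))) \<partial>M) = L * (N * L1_norm M ?A)"
    using intA by (simp add: A)
  finally have "L * (N * L1_norm M ?A) \<le> 6 * \<bar>real_of_int (a 2)\<bar> * real L ^ 2 + N * (real_of_int (a 1) * L1_norm M ?S) * (sqrt L * sqrt (2 * N))" .
  then have "L1_norm M ?A \<le> (6 * \<bar>real_of_int (a 2)\<bar> * real L ^ 2 + N * (real_of_int (a 1) * L1_norm M ?S) * (sqrt L * sqrt (2 * N))) / (L * N)"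
    using L N by (simp add: field_simps)
  \<comment> \<open>Division by \<open>L * N\<close> leaves \<open>L / N\<close> and
    \<open>sqrt (2 * N / L)\<close>; the factor \<open>sqrt 2\<close> is then rounded up to
    \<open>2\<close>.\<close>
  also have "\<dots> = 6 * \<bar>real_of_int (a 2)\<bar> * (real L / real N) + sqrt 2 * real_of_int (a 1) * (sqrt (real N / real L) * L1_norm M ?S)"
    using L N by (simp add: real_sqrt_mult real_sqrt_divide field_simps power2_eq_square)
  also have "\<dots> \<le> 6 * \<bar>real_of_int (a 2)\<bar> * (real L / real N) + 2 * real_of_int (a 1) * (sqrt (real N / real L) * L1_norm M ?S)"
    using a L1_norm_nonneg[of ?S] sqrt2_less_2
    by (intro add_left_mono mult_right_mono mult_nonneg_nonneg) auto
  finally show ?thesis .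
qed

end

subsection \<open>Box averages\<close>

lemma isqrt_pos: "N \<ge> 1 \<Longrightarrow> isqrt N \<ge> 1"
  unfolding isqrt_def by (simp add: le_nat_iff)

lemma isqrt_power2_le: "(real (isqrt N))\<^sup>2 \<le> real N"
proof -
  have "real (isqrt N) \<le> sqrt (real N)"
    unfolding isqrt_def by simp
  then have "(real (isqrt N))\<^sup>2 \<le> (sqrt (real N))\<^sup>2"
    by (rule power_mono) simp
  then show ?thesis by simp
qed

lemma isqrt_le: "isqrt N \<le> N"
proof (cases "isqrt N = 0")
  case False
  then have "real (isqrt N) \<le> (real (isqrt N))\<^sup>2"
    by (simp add: power2_eq_square mult_le_cancel_left1)
  with isqrt_power2_le[of N] show ?thesis by linarith
qed simp

text \<open>Jensen's inequality for the exponent \<open>2 ^ k\<close>, by applying Cauchy-Schwarz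
  \<open>k\<close> times.\<close>

lemma mean_power_le_mean_of_powers:
  fixes z :: "'b \<Rightarrow> real"
  assumes "finite D" "D \<noteq> {}" "\<And>d. d \<in> D \<Longrightarrow> z d \<ge> 0"
  shows "((\<Sum>d\<in>D. z d) / card D) ^ (2 ^ k) \<le> (\<Sum>d\<in>D. z d ^ (2 ^ k)) / card D"
  using assms(3)
proof (induction k arbitrary: z)
  case (Suc k)
  have c: "card D > 0" using assms by (simp add: card_gt_0_iff)
  have "((\<Sum>d\<in>D. z d) / card D) ^ 2 = (\<Sum>d\<in>D. z d)\<^sup>2 / (card D)\<^sup>2"
    by (simp add: power_divide)
  also have "\<dots> \<le> (card D * (\<Sum>d\<in>D. (z d)\<^sup>2)) / (card D)\<^sup>2"
    using sum_squared_le_sum_of_squares[of z D]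
    by (intro divide_right_mono) (auto simp: mult.commute)
  also have "\<dots> = (\<Sum>d\<in>D. (z d)\<^sup>2) / card D"
    using c by (simp add: power2_eq_square)
  finally have "(((\<Sum>d\<in>D. z d) / card D) ^ 2) ^ (2 ^ k) \<le> ((\<Sum>d\<in>D. (z d)\<^sup>2) / card D) ^ (2 ^ k)"
    by (rule power_mono) simp
  also have "\<dots> \<le> (\<Sum>d\<in>D. ((z d)\<^sup>2) ^ (2 ^ k)) / card D"
    by (rule Suc.IH) simp
  finally show ?case by (simp flip: power_mult)
qed simp

lemma power_add_le:
  fixes x y :: real
  assumes "x \<ge> 0" "y \<ge> 0"
  shows "(x + y) ^ p \<le> 2 ^ p * (x ^ p + y ^ p)"
proof -
  have "(x + y) ^ p \<le> (2 * max x y) ^ p"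
    using assms by (intro power_mono) auto
  also have "\<dots> = 2 ^ p * max x y ^ p" by (simp add: power_mult_distrib)
  also have "max x y ^ p \<le> x ^ p + y ^ p"
    using assms by (cases "x \<le> y") (auto simp: max_def)
  finally show ?thesis by simp
qed

section \<open>Splitting off the last coordinate of boxes and cubes\<close>

lemma bij_betw_PiE_Suc:
  "bij_betw (\<lambda>(e, h). h(Suc k := e)) (A \<times> ({1..k} \<rightarrow>\<^sub>E A)) ({1..Suc k} \<rightarrow>\<^sub>E A)"
proof -
  have "{1..Suc k} = insert (Suc k) {1..k}" by auto
  then show ?thesis
    unfolding bij_betw_def using inj_combinator[of "Suc k" "{1..k}" "\<lambda>_. A"]
    by (simp add: PiE_insert_eq)
qed

lemma sum_nat_box_Suc:
  "(\<Sum>h\<in>nat_box H (Suc k). F h) = (\<Sum>e=1..H. \<Sum>h\<in>nat_box H k. F (h(Suc k := e)))"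
  unfolding nat_box_def sum.cartesian_product
  by (subst sum.reindex_bij_betw[OF bij_betw_PiE_Suc, symmetric]) (simp add: split_def)

lemma prod_cube_Suc:
  "(\<Prod>\<eta>\<in>cube (Suc k). F \<eta>) = (\<Prod>\<eta>\<in>cube k. F (\<eta>(Suc k := 0)) * F (\<eta>(Suc k := 1)))"
proof -
  have "(\<Prod>\<eta>\<in>cube (Suc k). F \<eta>) = (\<Prod>\<epsilon>\<in>{0,1}. \<Prod>\<eta>\<in>cube k. F (\<eta>(Suc k := \<epsilon>)))"
    unfolding cube_def prod.cartesian_product
    by (subst prod.reindex_bij_betw[OF bij_betw_PiE_Suc, symmetric]) (simp add: split_def)
  then show ?thesis by (simp add: prod.distrib)
qed

lemma cube_size_Suc: "cube_size (Suc k) (\<eta>(Suc k := \<epsilon>)) = cube_size k \<eta> + \<epsilon>"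
  by (simp add: cube_size_def)

lemma dot_Suc: "dot (Suc k) (h(Suc k := e)) (\<eta>(Suc k := \<epsilon>)) = dot k h \<eta> + e * \<epsilon>"
  by (simp add: dot_def)

lemma funpow_cnj_mult: "(cnj ^^ s) (a * b) = (cnj ^^ s) a * (cnj ^^ s) b"
  by (induction s) auto

lemma norm_funpow_cnj [simp]: "norm ((cnj ^^ s) a) = norm a"
  by (induction s) auto

text \<open>A vertex with last coordinate \<open>1\<close> carries one more conjugation and a
  further shift by \<open>e\<close> than its partner with last coordinate \<open>0\<close>. Pairing
  the two differentiates \<open>f\<close> multiplicatively.\<close>

lemma cube_product_Suc:
  "cube_product T (Suc k) (h(Suc k := e)) f x = cube_product T k h (\<lambda>x. f x * cnj (f ((T ^^ e) x))) x"
  unfolding cube_product_def prod_cube_Suc cube_size_Suc dot_Suc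
  by (intro prod.cong refl)
    (simp add: funpow_cnj_mult funpow_swap1 add.commute[of _ e] funpow_add)

lemma cube_product_0: "cube_product T 0 h f x = f x"
  by (simp add: cube_product_def cube_def cube_size_def dot_def)

lemma borel_measurable_cnj [measurable (raw)]:
  assumes "f \<in> borel_measurable M"
  shows "(\<lambda>x. cnj (f x)) \<in> borel_measurable M"
  using assms by (rule measurable_compose)
    (intro borel_measurable_continuous_onI continuous_intros)

lemma funpow_cnj_measurable [measurable]: "cnj ^^ s \<in> borel_measurable borel"
  by (induction s) (auto intro: borel_measurable_cnj simp: o_def id_def)

lemma sup_twisted_average_cong:
  assumes "\<And>n. g ((T ^^ n) x) = g' ((T ^^ n) x)"
  shows "sup_twisted_average T g N x = sup_twisted_average T g' N x"
  unfolding sup_twisted_average_def using assms by simp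

context invertible_sys
begin

lemma L1_norm_cong:
  assumes "\<And>x. x \<in> space M \<Longrightarrow> norm (g x) = norm (g' x)"
  shows "L1_norm M g = L1_norm M g'"
  unfolding L1_norm_def using assms by (intro Bochner_Integration.integral_cong) auto

lemma cube_product_measurable [measurable]:
  assumes [measurable]: "f \<in> borel_measurable M"
  shows "cube_product T k h f \<in> borel_measurable M"
  unfolding cube_product_def by measurable

lemma cube_product_U:
  assumes "x \<in> space M"
  shows "cube_product T k h (\<lambda>y. f (U c y)) x = cube_product T k h f (U c x)"
proof -
  have "U c ((T ^^ n) x) = (T ^^ n) (U c x)" for n
    using assms by (simp add: funpow_U flip: U_of_nat U_add) (simp add: add.commute)
  then show ?thesis by (simp add: cube_product_def)
qed

text \<open>With \<open>k = J - 2\<close> and \<open>f = f 1\<close>, this is the quantity whose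
  root appears on the right-hand side of the theorem.\<close>

definition box_average :: "nat \<Rightarrow> ('a \<Rightarrow> complex) \<Rightarrow> nat \<Rightarrow> real" where
  "box_average k f N = 1 / real (isqrt N) ^ k *
     (\<Sum>h\<in>nat_box (isqrt N) k. L1_norm M (sup_twisted_average T (cube_product T k h f) N) powr (2 / 3))"

lemma box_average_nonneg: "0 \<le> box_average k f N"
  unfolding box_average_def by (intro mult_nonneg_nonneg sum_nonneg) auto

lemma box_average_0: "box_average 0 f N = L1_norm M (sup_twisted_average T f N) powr (2 / 3)"
proof -
  have "cube_product T 0 h f = f" for h by (rule ext) (rule cube_product_0)
  then show ?thesis by (simp add: box_average_def nat_box_def)
qed

text \<open>This recursion drives the induction: the last shift \<open>e\<close> plays the role of
  the van der Corput shift, and what remains is a box average of a derivative of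
  \<open>f\<close>.\<close>

lemma box_average_Suc:
  "box_average (Suc k) f N
    = 1 / real (isqrt N) * (\<Sum>e=1..isqrt N. box_average k (\<lambda>x. f x * cnj (f ((T ^^ e) x))) N)"
  unfolding box_average_def sum_nat_box_Suc cube_product_Suc[abs_def]
  by (simp add: sum_distrib_left)

text \<open>\<open>U c\<close> commutes with \<open>T\<close>, so the supremum for the translated
  function is the translate of the original supremum and has the same norm.\<close>

lemma box_average_U:
  assumes [measurable]: "f \<in> borel_measurable M"
  shows "box_average k (\<lambda>x. f (U c x)) N = box_average k f N"
proof -
  have "L1_norm M (sup_twisted_average T (cube_product T k h (\<lambda>x. f (U c x))) N)
      = L1_norm M (sup_twisted_average T (cube_product T k h f) N)" for h
  proof -
    have "sup_twisted_average T (cube_product T k h (\<lambda>x. f (U c x))) N x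
        = sup_twisted_average T (cube_product T k h f) N (U c x)" if "x \<in> space M" for x
      using that
      by (subst sup_twisted_average_U[symmetric, OF that], intro sup_twisted_average_cong)
        (simp add: cube_product_U funpow_space)
    then have "L1_norm M (sup_twisted_average T (cube_product T k h (\<lambda>x. f (U c x))) N)
        = L1_norm M (\<lambda>x. sup_twisted_average T (cube_product T k h f) N (U c x))"
      by (intro L1_norm_cong) simp
    also have "\<dots> = L1_norm M (sup_twisted_average T (cube_product T k h f) N)"
      by (rule L1_norm_U) measurable
    finally show ?thesis .
  qed
  then show ?thesis by (simp add: box_average_def)
qed

text \<open>
  Raising to the power \<open>2\<^sup>k\<close> keeps the induction free of fractional exponents.
\<close>

definition power_bound :: "nat \<Rightarrow> (nat \<Rightarrow> int) \<Rightarrow> real \<Rightarrow> bool" where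
  "power_bound k a C \<longleftrightarrow> (\<forall>f N. bounded_family f \<longrightarrow> N \<ge> 1 \<longrightarrow>
     L1_norm M (multiple_average M T (k + 2) a f N) ^ (2 ^ k)
       \<le> C * (1 / real (isqrt N) + box_average k (f 1) N))"

text \<open>Reversing the order of summation changes the sign of every exponent. The leftover shift
  by \<open>a j * (N + 1)\<close> is absorbed into \<open>f j\<close>, and box averages are
  invariant under it.\<close>

lemma power_bound_uminus:
  assumes "power_bound k (\<lambda>j. - a j) C"
  shows "power_bound k a C"
  unfolding power_bound_def
proof (intro allI impI)
  fix f N assume f: "bounded_family f" and N: "N \<ge> (1::nat)"
  note fD = bounded_familyD[OF f]
  have [measurable]: "f j \<in> borel_measurable M" for j by (rule fD)
  define f' where "f' j x = f j (U (a j * (int N + 1)) x)" for j x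
  have "bounded_family f'"
    unfolding bounded_family_def f'_def[abs_def] using fD by auto
  then have "L1_norm M (multiple_average M T (k + 2) (\<lambda>j. - a j) f' N) ^ (2 ^ k)
       \<le> C * (1 / real (isqrt N) + box_average k (f' 1) N)"
    using assms N by (simp add: power_bound_def)
  also have "box_average k (f' 1) N = box_average k (f 1) N"
    unfolding f'_def[abs_def] by (intro box_average_U) measurable
  also have "L1_norm M (multiple_average M T (k + 2) (\<lambda>j. - a j) f' N)
     = L1_norm M (multiple_average M T (k + 2) a f N)"
  proof (intro L1_norm_cong arg_cong[where f = norm])
    fix x assume x: "x \<in> space M"
    have "(\<Sum>n=1..N. \<Prod>j=1..k+2. f' j (U (- a j * int n) x))
      = (\<Sum>n=1..N. \<Prod>j=1..k+2. f j (U (a j * int (N + 1 - n)) x))"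
      using x by (intro sum.cong prod.cong refl)
        (simp add: f'_def of_nat_diff algebra_simps flip: U_add)
    also have "\<dots> = (\<Sum>n=1..N. \<Prod>j=1..k+2. f j (U (a j * int n) x))"
      by (intro sum.reindex_bij_witness[where i = "\<lambda>n. N + 1 - n" and j = "\<lambda>n. N + 1 - n"]) auto
    finally show "multiple_average M T (k + 2) (\<lambda>j. - a j) f' N x = multiple_average M T (k + 2) a f N x"
      by (simp add: multiple_average_def)
  qed
  finally show "L1_norm M (multiple_average M T (k + 2) a f N) ^ (2 ^ k)
       \<le> C * (1 / real (isqrt N) + box_average k (f 1) N)" .
qed

text \<open>Taking \<open>L\<close> about \<open>\<delta> * N\<close> balances
  \<open>bilinear_average_bound\<close>: \<open>L / N\<close> is at most
  \<open>\<delta> + 1 / N\<close>, and \<open>sqrt (N / L) * s\<close> is at most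
  \<open>\<delta>\<close> because \<open>s = \<delta> powr (3 / 2)\<close>.\<close>

lemma power_bound_0:
  assumes a: "a 1 > 0" "a 2 \<noteq> 0" "a 1 \<noteq> a 2"
  shows "power_bound 0 a (6 * \<bar>real_of_int (a 2)\<bar> + 2 * real_of_int (a 1))"
  unfolding power_bound_def
proof (intro allI impI)
  fix f N assume f: "bounded_family f" and N: "N \<ge> (1::nat)"
  let ?A = "multiple_average M T 2 a f N"
  define s where "s = L1_norm M (sup_twisted_average T (f 1) N)"
  define \<delta> where "\<delta> = s powr (2 / 3)"
  have s: "0 \<le> s" "s \<le> 1"
    unfolding s_def using sup_twisted_average_le_1[of "f 1"] bounded_familyD[OF f] sup_twisted_average_nonneg[of T "f 1"]
    by (auto intro!: L1_norm_nonneg L1_norm_le_1)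
  then have \<delta>: "0 \<le> \<delta>" "\<delta> \<le> 1" by (auto simp: \<delta>_def powr_le1)
  \<comment> \<open>The maximum keeps \<open>L\<close> positive when \<open>\<delta> = 0\<close>,
    and \<open>\<delta> \<le> 1\<close> will give \<open>L \<le> N\<close>.\<close>
  define L where "L = max 1 (nat \<lceil>\<delta> * N\<rceil>)"
  have "\<delta> * N \<le> N" using \<delta> by (simp add: mult_left_le_one_le)
  then have "nat \<lceil>\<delta> * N\<rceil> \<le> N" by (simp add: ceiling_le_iff nat_le_iff)
  with N have L: "1 \<le> L" "L \<le> N" by (auto simp: L_def)
  have "real L \<le> \<delta> * N + 1"
    using \<delta> by (auto simp: L_def max_def)
  then have LN: "real L / real N \<le> \<delta> + 1 / N"
    using N by (simp add: field_simps)
  have NL: "sqrt (real N / real L) * s \<le> \<delta>"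
  proof (cases "s = 0")
    case False
    with s have s0: "s > 0" by simp
    then have \<delta>0: "\<delta> > 0" by (simp add: \<delta>_def)
    have "\<delta> * N \<le> L" by (simp add: L_def) linarith
    then have "real N / real L \<le> 1 / \<delta>"
      using L \<delta>0 by (simp add: field_simps)
    then have "sqrt (real N / real L) * s \<le> sqrt (1 / \<delta>) * s"
      using s by (intro mult_right_mono) auto
    also have "sqrt (1 / \<delta>) = s powr (- 1 / 3)"
      using s0 by (simp add: \<delta>_def powr_half_sqrt[symmetric] powr_powr powr_minus_divide[symmetric])
    also have "s powr (- 1 / 3) * s = s powr (- 1 / 3 + 1)"
      using s0 by (simp only: powr_add powr_one)
    also have "\<dots> = \<delta>" by (simp add: \<delta>_def)
    finally show ?thesis .
  qed (use \<delta> in simp)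
  \<comment> \<open>The rounding error \<open>1 / N\<close> in \<open>L / N\<close> is absorbed by
    the coarser term \<open>1 / isqrt N\<close>.\<close>
  have HN: "1 / real N \<le> 1 / real (isqrt N)"
    using isqrt_le[of N] isqrt_pos[OF N] N by (intro divide_left_mono) auto
  have "L1_norm M ?A \<le> 6 * \<bar>real_of_int (a 2)\<bar> * (real L / real N) + 2 * real_of_int (a 1) * (sqrt (real N / real L) * s)"
    unfolding s_def using f a L by (rule bilinear_average_bound)
  also have "\<dots> \<le> 6 * \<bar>real_of_int (a 2)\<bar> * (\<delta> + 1 / real (isqrt N)) + 2 * real_of_int (a 1) * \<delta>"
    using LN HN NL a by (intro add_mono mult_left_mono) auto
  also have "\<dots> \<le> (6 * \<bar>real_of_int (a 2)\<bar> + 2 * real_of_int (a 1)) * (1 / real (isqrt N) + \<delta>)"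
    using a by (simp add: algebra_simps)
  finally show "L1_norm M (multiple_average M T (0 + 2) a f N) ^ (2 ^ 0)
       \<le> (6 * \<bar>real_of_int (a 2)\<bar> + 2 * real_of_int (a 1)) * (1 / real (isqrt N) + box_average 0 (f 1) N)"
    by (simp add: box_average_0 \<delta>_def s_def numeral_2_eq_2)
qed

end

subsection \<open>The van der Corput step\<close>

lemma norm_sum_shift_diff_le:
  fixes v :: "nat \<Rightarrow> 'b::real_normed_vector"
  assumes "\<And>n. norm (v n) \<le> 1"
  shows "norm ((\<Sum>n=1..N. v (n + h)) - (\<Sum>n=1..N. v n)) \<le> 2 * real h"
proof (induction h)
  case (Suc h)
  have "(\<Sum>n=1..N. v (n + Suc h)) - (\<Sum>n=1..N. v (n + h)) = (\<Sum>n=1..N. v (Suc (n + h)) - v (n + h))"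
    by (simp add: sum_subtractf)
  \<comment> \<open>Telescoping leaves only the two end terms, so each unit of shift costs at most
    \<open>2\<close>.\<close>
  also have "\<dots> = v (N + h + 1) - v (h + 1)"
    by (induction N) auto
  also have "norm \<dots> \<le> 2"
    using norm_triangle_ineq4[of "v (N + h + 1)" "v (h + 1)"] assms[of "N + h + 1"] assms[of "h + 1"] by linarith
  finally have "norm ((\<Sum>n=1..N. v (n + Suc h)) - (\<Sum>n=1..N. v (n + h))) \<le> 2" .
  with Suc norm_triangle_ineq[of "(\<Sum>n=1..N. v (n + Suc h)) - (\<Sum>n=1..N. v (n + h))"
     "(\<Sum>n=1..N. v (n + h)) - (\<Sum>n=1..N. v n)"]
  show ?case by simp
qed simp

text \<open>\<open>K\<close> copies of the sum are compared with the sums over windows shifted by up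
  to \<open>K\<close>; then come Cauchy-Schwarz in \<open>n\<close> and expansion of the square.
  Values of \<open>v\<close> beyond \<open>N\<close> are kept rather than cut off, so all
  correlations have the same \<open>N\<close> indices.\<close>

lemma van_der_corput:
  fixes v :: "nat \<Rightarrow> complex"
  assumes v: "\<And>n. norm (v n) \<le> 1" and N: "N \<ge> 1" and K: "K \<ge> 1"
  shows "(norm ((1 / of_nat N) * (\<Sum>n=1..N. v n)))\<^sup>2
    \<le> 8 * (real K / real N)\<^sup>2 + 2 / (real K)\<^sup>2 *
       (\<Sum>h=1..K. \<Sum>h'=1..K. Re ((1 / of_nat N) * (\<Sum>n=1..N. v (n + h) * cnj (v (n + h')))))"
proof -
  define X where "X = (\<Sum>n=1..N. v n)"
  define Y where "Y = (\<Sum>n=1..N. \<Sum>h=1..K. v (n + h))"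
  have "Y - of_nat K * X = (\<Sum>h=1..K. (\<Sum>n=1..N. v (n + h)) - (\<Sum>n=1..N. v n))"
    unfolding Y_def X_def by (subst sum.swap) (simp add: sum_subtractf)
  also have "norm \<dots> \<le> (\<Sum>h=1..K. 2 * real K)"
    by (intro sum_norm_le order_trans[OF norm_sum_shift_diff_le[OF v]]) auto
  finally have "norm (of_nat K * X) \<le> 2 * (real K)\<^sup>2 + norm Y"
    using norm_triangle_sub[of "of_nat K * X" Y] by (simp add: norm_minus_commute power2_eq_square)
  then have "(real K * norm X)\<^sup>2 \<le> (2 * (real K)\<^sup>2 + norm Y)\<^sup>2"
    by (intro power_mono) (auto simp: norm_mult)
  \<comment> \<open>The boundary part \<open>2 * (2 * K\<^sup>2)\<^sup>2 = 8 * K ^ 4\<close> becomes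
    \<open>8 * (K / N)\<^sup>2\<close> after division by \<open>(K * N)\<^sup>2\<close>.\<close>
  also have "\<dots> \<le> 2 * (2 * (real K)\<^sup>2)\<^sup>2 + 2 * (norm Y)\<^sup>2"
    using sum_squares_bound[of "2 * (real K)\<^sup>2" "norm Y"] by (simp add: power2_sum)
  also have "(norm Y)\<^sup>2 \<le> (\<Sum>n=1..N. norm (\<Sum>h=1..K. v (n + h)))\<^sup>2"
    unfolding Y_def by (intro power_mono norm_sum) auto
  also have "\<dots> \<le> real N * (\<Sum>n=1..N. (norm (\<Sum>h=1..K. v (n + h)))\<^sup>2)"
    using sum_squared_le_sum_of_squares[of "\<lambda>n. norm (\<Sum>h=1..K. v (n + h))" "{1..N}"]
    by (simp add: mult.commute)
  also have "(\<Sum>n=1..N. (norm (\<Sum>h=1..K. v (n + h)))\<^sup>2)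
    = (\<Sum>n=1..N. \<Sum>h=1..K. \<Sum>h'=1..K. Re (v (n + h) * cnj (v (n + h'))))"
  proof (rule sum.cong[OF refl])
    fix n
    have "(norm (\<Sum>h=1..K. v (n + h)))\<^sup>2 = Re ((\<Sum>h=1..K. v (n + h)) * cnj (\<Sum>h=1..K. v (n + h)))"
      by (metis Re_complex_of_real complex_norm_square)
    then show "(norm (\<Sum>h=1..K. v (n + h)))\<^sup>2 = (\<Sum>h=1..K. \<Sum>h'=1..K. Re (v (n + h) * cnj (v (n + h'))))"
      by (simp only: sum_product cnj_sum Re_sum)
  qed
  also have "\<dots> = (\<Sum>h=1..K. \<Sum>h'=1..K. Re (\<Sum>n=1..N. v (n + h) * cnj (v (n + h'))))" (is "_ = ?S")
    unfolding Re_sum by (subst sum.swap, rule sum.cong[OF refl], rule sum.swap)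
  finally have main: "(real K * norm X)\<^sup>2 \<le> 2 * (2 * (real K)\<^sup>2)\<^sup>2 + 2 * (real N * ?S)"
    by simp
  have "(norm ((1 / of_nat N) * X))\<^sup>2 = (real K * norm X)\<^sup>2 / (real K * real N)\<^sup>2"
    using K N by (simp add: norm_mult norm_divide power_divide power_mult_distrib)
  also have "\<dots> \<le> (2 * (2 * (real K)\<^sup>2)\<^sup>2 + 2 * (real N * ?S)) / (real K * real N)\<^sup>2"
    using main by (rule divide_right_mono) simp
  also have "\<dots> = 8 * (real K / real N)\<^sup>2 + 2 / (real K)\<^sup>2 * (?S / real N)"
    using K N by (simp add: power2_eq_square field_simps)
  also have "?S / real N = (\<Sum>h=1..K. \<Sum>h'=1..K. Re ((1 / of_nat N) * (\<Sum>n=1..N. v (n + h) * cnj (v (n + h')))))"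
    by (simp add: sum_divide_distrib Re_divide_of_nat)
  finally show ?thesis by (simp add: X_def)
qed

text \<open>For fixed \<open>h\<close> the difference \<open>0\<close> occurs once and every
  positive difference at most twice, once on each side of \<open>h\<close>.\<close>

lemma sum_abs_diff_le:
  fixes c :: "nat \<Rightarrow> real"
  assumes "\<And>d. c d \<ge> 0"
  shows "(\<Sum>h=1..K. \<Sum>h'=1..K. c (nat \<bar>int h - int h'\<bar>)) \<le> real K * (c 0 + 2 * (\<Sum>d=1..K. c d))"
proof -
  have "(\<Sum>h'=1..K. c (nat \<bar>int h - int h'\<bar>)) \<le> c 0 + 2 * (\<Sum>d=1..K. c d)" if h: "h \<in> {1..K}" for h
  proof -
    have "(\<Sum>h'\<in>{1..<h}. c (nat \<bar>int h - int h'\<bar>)) = (\<Sum>d\<in>{1..<h}. c d)"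
      by (intro sum.reindex_bij_witness[where i = "\<lambda>d. h - d" and j = "\<lambda>d. h - d"]) (auto simp: of_nat_diff nat_diff_distrib)
    also have "\<dots> \<le> (\<Sum>d=1..K. c d)"
      using h assms by (intro sum_mono2) auto
    finally have 1: "(\<Sum>h'\<in>{1..<h}. c (nat \<bar>int h - int h'\<bar>)) \<le> (\<Sum>d=1..K. c d)" .
    have "(\<Sum>h'\<in>{h<..K}. c (nat \<bar>int h - int h'\<bar>)) = (\<Sum>d\<in>{1..K-h}. c d)"
      using h by (intro sum.reindex_bij_witness[where i = "\<lambda>d. h + d" and j = "\<lambda>h'. h' - h"]) (auto simp: nat_diff_distrib of_nat_diff)
    also have "\<dots> \<le> (\<Sum>d=1..K. c d)"
      using h assms by (intro sum_mono2) auto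
    finally have 2: "(\<Sum>h'\<in>{h<..K}. c (nat \<bar>int h - int h'\<bar>)) \<le> (\<Sum>d=1..K. c d)" .
    have K: "{1..K} = {1..<h} \<union> insert h {h<..K}" using h by auto
    have "(\<Sum>h'=1..K. c (nat \<bar>int h - int h'\<bar>))
      = (\<Sum>h'\<in>{1..<h}. c (nat \<bar>int h - int h'\<bar>)) + (c 0 + (\<Sum>h'\<in>{h<..K}. c (nat \<bar>int h - int h'\<bar>)))"
      unfolding K by (subst sum.union_disjoint) auto
    with 1 2 show ?thesis by simp
  qed
  from sum_mono[where K = "{1..K}", OF this] show ?thesis by simp
qed

section \<open>The van der Corput inequality for multiple averages\<close>

context invertible_sys
begin

lemma L1_norm_power2_le:
  fixes g :: "'a \<Rightarrow> complex"
  assumes [measurable]: "g \<in> borel_measurable M" and "\<And>x. norm (g x) \<le> 1"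
  shows "(L1_norm M g)\<^sup>2 \<le> (\<integral>x. (norm (g x))\<^sup>2 \<partial>M)"
proof -
  have i: "integrable M (\<lambda>x. norm (g x))" "integrable M (\<lambda>x. (norm (g x))\<^sup>2)"
    using assms by (auto intro!: integrable_bounded[where B = 1] power_le_one)
  have "0 \<le> variance (\<lambda>x. norm (g x))" by (rule variance_positive)
  then show ?thesis
    using variance_eq[OF i] by (simp add: L1_norm_def)
qed

lemma norm_integral_le:
  fixes f :: "'a \<Rightarrow> complex" and g :: "'a \<Rightarrow> real"
  assumes "integrable M f" "integrable M g" "\<And>x. norm (f x) \<le> g x"
  shows "norm (\<integral>x. f x \<partial>M) \<le> (\<integral>x. g x \<partial>M)"
proof -
  have "norm (\<integral>x. f x \<partial>M) \<le> (\<integral>x. norm (f x) \<partial>M)"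
    by (rule integral_norm_bound)
  also have "\<dots> \<le> (\<integral>x. g x \<partial>M)"
    using assms by (intro integral_mono) auto
  finally show ?thesis .
qed

text \<open>The van der Corput shift \<open>d\<close> reaches \<open>f j\<close> through its
  exponent, so \<open>f 1\<close> is differentiated only along multiples of
  \<open>a 1\<close>.\<close>

definition multiplicative_derivative :: "(nat \<Rightarrow> int) \<Rightarrow> nat \<Rightarrow> (nat \<Rightarrow> 'a \<Rightarrow> complex) \<Rightarrow> nat \<Rightarrow> 'a \<Rightarrow> complex" where
  "multiplicative_derivative a d f j x = f j x * cnj (f j (U (a j * int d) x))"

lemma bounded_family_derivative:
  assumes "bounded_family f"
  shows "bounded_family (multiplicative_derivative a d f)"
proof -
  have [measurable]: "f j \<in> borel_measurable M" for j by (rule bounded_familyD[OF assms])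
  have "(\<lambda>x. f j x * cnj (f j (U (a j * int d) x))) \<in> borel_measurable M" for j
    by (intro borel_measurable_times borel_measurable_cnj) measurable
  then show ?thesis
    using bounded_familyD(2)[OF assms]
    by (auto simp: bounded_family_def multiplicative_derivative_def[abs_def] norm_mult mult_le_one)
qed

text \<open>Composing the \<open>p\<close>-th term with \<open>U (- a (Suc J) * p)\<close> leaves
  its integral unchanged and frees the last function from \<open>p\<close>. That function is bounded
  by \<open>1\<close> and can be taken out of the sum, leaving an average of \<open>J\<close>
  functions.\<close>

lemma correlation_bound:
  fixes f :: "nat \<Rightarrow> 'a \<Rightarrow> complex" and a :: "nat \<Rightarrow> int" and J :: nat
  assumes f: "bounded_family f" and N: "N \<ge> 1" and h: "h \<le> K"
  defines "v \<equiv> \<lambda>n x. \<Prod>j=1..Suc J. f j (U (a j * int n) x)"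
  shows "norm (\<integral>x. (1 / of_nat N) * (\<Sum>n=1..N. v (n + h) x * cnj (v (n + h + d) x)) \<partial>M)
    \<le> L1_norm M (multiple_average M T J (\<lambda>j. a j - a (Suc J)) (multiplicative_derivative a d f) N)
      + 2 * real K / real N"
proof -
  define g where "g = multiplicative_derivative a d f"
  have g: "bounded_family g" unfolding g_def by (rule bounded_family_derivative[OF f])
  define b where "b j = a j - a (Suc J)" for j
  define w where "w n x = (\<Prod>j=1..J. g j (U (b j * int n) x))" for n x
  let ?A = "multiple_average M T J b g N"
  have [measurable]: "f j \<in> borel_measurable M" "g j \<in> borel_measurable M" for j
    by (rule bounded_familyD[OF f] bounded_familyD[OF g])+
  have v[measurable]: "v n \<in> borel_measurable M" for n
    unfolding v_def by measurable
  have w[measurable]: "w n \<in> borel_measurable M" for n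
    unfolding w_def[abs_def] by measurable
  have v1: "norm (v n x) \<le> 1" for n x
    unfolding v_def by (intro norm_prod_le_1 bounded_familyD[OF f])
  have w1: "norm (w n x) \<le> 1" for n x
    unfolding w_def by (intro norm_prod_le_1 bounded_familyD[OF g])
  have intw: "integrable M (\<lambda>x. g (Suc J) x * w n x)" for n
    using w1 bounded_familyD[OF g]
    by (intro integrable_bounded[where B = 1]) (auto simp: norm_mult mult_le_one)
  have [measurable]: "(\<lambda>x. cnj (v n x)) \<in> borel_measurable M" for n
    by (intro borel_measurable_cnj v)
  have intv: "integrable M (\<lambda>x. v m x * cnj (v n x))" for m n
    using v1 by (intro integrable_bounded[where B = 1]) (auto simp: norm_mult mult_le_one)
  have corr: "(\<integral>x. v p x * cnj (v (p + d) x) \<partial>M) = (\<integral>x. g (Suc J) x * w p x \<partial>M)" for p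
  proof -
    have "(\<integral>x. v p x * cnj (v (p + d) x) \<partial>M)
      = (\<integral>x. v p (U (- a (Suc J) * int p) x) * cnj (v (p + d) (U (- a (Suc J) * int p) x)) \<partial>M)"
      by (rule integral_U[symmetric]) measurable
    also have "\<dots> = (\<integral>x. g (Suc J) x * w p x \<partial>M)"
    proof (rule Bochner_Integration.integral_cong[OF refl])
      fix x assume x: "x \<in> space M"
      have "v p (U (- a (Suc J) * int p) x) * cnj (v (p + d) (U (- a (Suc J) * int p) x))
        = (\<Prod>j=1..Suc J. g j (U (b j * int p) x))"
        unfolding v_def cnj_prod prod.distrib[symmetric] g_def multiplicative_derivative_def b_def using x
        by (intro prod.cong refl) (simp add: algebra_simps flip: U_add)
      \<comment> \<open>The exponent \<open>b (Suc J)\<close> is \<open>0\<close>, so the last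
        factor is evaluated at \<open>x\<close> itself.\<close>
      also have "\<dots> = g (Suc J) x * w p x"
        by (simp add: w_def b_def)
      finally show "v p (U (- a (Suc J) * int p) x) * cnj (v (p + d) (U (- a (Suc J) * int p) x)) = g (Suc J) x * w p x" .
    qed
    finally show ?thesis .
  qed
  have A[measurable]: "?A \<in> borel_measurable M"
    by (intro multiple_average_measurable) measurable
  have intA: "integrable M (\<lambda>x. norm (?A x))"
    using norm_multiple_average_le_1[OF g] by (intro integrable_bounded[where B = 1]) auto
  have "(\<integral>x. (1 / of_nat N) * (\<Sum>n=1..N. v (n + h) x * cnj (v (n + h + d) x)) \<partial>M)
    = (1 / of_nat N) * (\<Sum>n=1..N. \<integral>x. v (n + h) x * cnj (v (n + h + d) x) \<partial>M)"
    using intv by (simp del: times_divide_eq_left)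
  also have "\<dots> = (1 / of_nat N) * (\<Sum>n=1..N. \<integral>x. g (Suc J) x * w (n + h) x \<partial>M)"
    by (simp only: corr)
  also have "\<dots> = (\<integral>x. (1 / of_nat N) * (\<Sum>n=1..N. g (Suc J) x * w (n + h) x) \<partial>M)"
    using intw by (simp del: times_divide_eq_left)
  also have "norm \<dots> \<le> (\<integral>x. norm (?A x) + 2 * real K / real N \<partial>M)"
  proof (rule norm_integral_le)
    show "integrable M (\<lambda>x. (1 / of_nat N) * (\<Sum>n=1..N. g (Suc J) x * w (n + h) x))"
      using intw by (intro integrable_mult_right Bochner_Integration.integrable_sum)
    show "integrable M (\<lambda>x. norm (?A x) + 2 * real K / real N)"
      using intA by simp
    fix x
    \<comment> \<open>Moving the window back by \<open>h\<close> costs at most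
      \<open>2 * h \<le> 2 * K\<close>.\<close>
    have "norm (\<Sum>n=1..N. w (n + h) x) \<le> norm (\<Sum>n=1..N. w n x) + 2 * real K"
      using norm_sum_shift_diff_le[where v = "\<lambda>n. w n x" and N = N and h = h, OF w1] h
        norm_triangle_sub[of "\<Sum>n=1..N. w (n + h) x" "\<Sum>n=1..N. w n x"] by simp
    then have "norm (\<Sum>n=1..N. w (n + h) x) / N \<le> (norm (\<Sum>n=1..N. w n x) + 2 * real K) / N"
      by (rule divide_right_mono) simp
    also have "\<dots> = norm (?A x) + 2 * real K / real N"
      by (simp add: multiple_average_def w_def norm_mult norm_divide add_divide_distrib)
    finally have "norm (\<Sum>n=1..N. w (n + h) x) / N \<le> norm (?A x) + 2 * real K / real N" .
    moreover have "norm ((1 / of_nat N) * (\<Sum>n=1..N. g (Suc J) x * w (n + h) x))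
      \<le> norm (\<Sum>n=1..N. w (n + h) x) / N"
      using bounded_familyD(2)[OF g, of "Suc J" x]
      by (simp add: norm_mult norm_divide mult_left_le_one_le divide_right_mono flip: sum_distrib_left)
    ultimately show "norm ((1 / of_nat N) * (\<Sum>n=1..N. g (Suc J) x * w (n + h) x))
      \<le> norm (?A x) + 2 * real K / real N" by linarith
  qed
  also have "\<dots> = L1_norm M ?A + 2 * real K / real N"
    using intA by (simp add: L1_norm_def prob_space)
  finally show ?thesis unfolding g_def b_def[abs_def] .
qed

text \<open>The condition \<open>K\<^sup>2 \<le> N\<close> brings every boundary error down to order
  \<open>1 / K\<close>. The constant \<open>18\<close> collects \<open>8\<close> from shifting the
  windows, \<open>2\<close> from the diagonal and \<open>8\<close> from the errors in the
  correlations.\<close>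

lemma van_der_corput_average:
  assumes f: "bounded_family f" and K: "K \<ge> 1" "K\<^sup>2 \<le> N"
  shows "(L1_norm M (multiple_average M T (Suc J) a f N))\<^sup>2
    \<le> 18 / real K + 4 / real K * (\<Sum>d=1..K.
       L1_norm M (multiple_average M T J (\<lambda>j. a j - a (Suc J)) (multiplicative_derivative a d f) N))"
proof -
  have "K \<le> K\<^sup>2" using K by (simp add: power2_eq_square)
  then have KN: "K \<le> N" using K(2) by (rule order_trans)
  then have N: "N \<ge> 1" using K by simp
  define v where "v n x = (\<Prod>j=1..Suc J. f j (U (a j * int n) x))" for n x
  define y where "y d = L1_norm M (multiple_average M T J (\<lambda>j. a j - a (Suc J)) (multiplicative_derivative a d f) N)" for d
  \<comment> \<open>The diagonal correlations get only the trivial bound \<open>1\<close>; there are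
    \<open>K\<close> of them among \<open>K\<^sup>2\<close>, which contributes order
    \<open>1 / K\<close>.\<close>
  define c where "c d = (if d = 0 then 1 else y d + 2 * real K / real N)" for d
  define W where "W h h' x = (1 / of_nat N) * (\<Sum>n=1..N. v (n + h) x * cnj (v (n + h') x))" for h h' x
  have y: "y d \<ge> 0" for d unfolding y_def by (rule L1_norm_nonneg)
  then have c: "c d \<ge> 0" for d by (simp add: c_def)
  have [measurable]: "f j \<in> borel_measurable M" for j
    by (rule bounded_familyD[OF f])
  have v[measurable]: "v n \<in> borel_measurable M" for n
    unfolding v_def[abs_def] by measurable
  have [measurable]: "(\<lambda>x. cnj (v n x)) \<in> borel_measurable M" for n
    by (intro borel_measurable_cnj v)
  have v1: "norm (v n x) \<le> 1" for n x
    unfolding v_def by (intro norm_prod_le_1 bounded_familyD[OF f])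
  have W1: "norm (W h h' x) \<le> 1" for h h' x
  proof -
    have "norm (\<Sum>n=1..N. v (n + h) x * cnj (v (n + h') x)) \<le> (\<Sum>n=1..N. 1)"
      using v1 by (intro sum_norm_le) (auto simp: norm_mult mult_le_one)
    then show ?thesis using N by (simp add: W_def norm_mult norm_divide)
  qed
  have [measurable]: "W h h' \<in> borel_measurable M" for h h'
    unfolding W_def[abs_def] by measurable
  have intW: "integrable M (W h h')" for h h'
    using W1 by (intro integrable_bounded[where B = 1]) auto
  have Wle: "norm (\<integral>x. W h (h + d) x \<partial>M) \<le> c d" if "h \<le> K" for h d
  proof (cases "d = 0")
    case True
    have "norm (\<integral>x. W h (h + d) x \<partial>M) \<le> (\<integral>x. 1 \<partial>M)"
      using intW W1 by (intro norm_integral_le) auto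
    then show ?thesis using True by (simp add: c_def prob_space)
  next
    case False
    then show ?thesis
      using correlation_bound[OF f N that, where J = J and a = a and d = d]
      by (simp add: c_def y_def W_def v_def add.assoc)
  qed
  have Wc: "Re (\<integral>x. W h h' x \<partial>M) \<le> c (nat \<bar>int h - int h'\<bar>)" if "h \<le> K" "h' \<le> K" for h h'
  proof (cases "h \<le> h'")
    case True
    then show ?thesis
      using Wle[of h "h' - h"] that complex_Re_le_cmod[of "\<integral>x. W h h' x \<partial>M"] by (simp add: nat_diff_distrib')
  next
    case False
    \<comment> \<open>Exchanging \<open>h\<close> and \<open>h'\<close> conjugates the correlation
      and preserves its norm, which reduces to nonnegative shifts.\<close>
    have "W h h' x = cnj (W h' h x)" for x
      by (simp add: W_def cnj_sum mult.commute)
    then have "(\<integral>x. W h h' x \<partial>M) = cnj (\<integral>x. W h' h x \<partial>M)"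
      by simp
    then have "Re (\<integral>x. W h h' x \<partial>M) \<le> norm (\<integral>x. W h' h x \<partial>M)"
      using complex_Re_le_cmod[of "\<integral>x. W h' h x \<partial>M"] by simp
    then show ?thesis
      using Wle[of h' "h - h'"] that False by (simp add: nat_diff_distrib')
  qed
  have "(L1_norm M (multiple_average M T (Suc J) a f N))\<^sup>2
     \<le> (\<integral>x. (norm (multiple_average M T (Suc J) a f N x))\<^sup>2 \<partial>M)"
    by (intro L1_norm_power2_le multiple_average_measurable norm_multiple_average_le_1 f) measurable
  also have "\<dots> \<le> (\<integral>x. 8 * (real K / real N)\<^sup>2 + 2 / (real K)\<^sup>2 * (\<Sum>h=1..K. \<Sum>h'=1..K. Re (W h h' x)) \<partial>M)"
  proof (rule integral_mono)
    show "integrable M (\<lambda>x. (norm (multiple_average M T (Suc J) a f N x))\<^sup>2)"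
      using norm_multiple_average_le_1[OF f] multiple_average_measurable[of "Suc J" f a N]
      by (intro integrable_bounded[where B = 1]) (auto simp: power_le_one)
    show "integrable M (\<lambda>x. 8 * (real K / real N)\<^sup>2 + 2 / (real K)\<^sup>2 * (\<Sum>h=1..K. \<Sum>h'=1..K. Re (W h h' x)))"
      using intW by (intro Bochner_Integration.integrable_add integrable_mult_right Bochner_Integration.integrable_sum) auto
    fix x
    show "(norm (multiple_average M T (Suc J) a f N x))\<^sup>2
      \<le> 8 * (real K / real N)\<^sup>2 + 2 / (real K)\<^sup>2 * (\<Sum>h=1..K. \<Sum>h'=1..K. Re (W h h' x))"
      using van_der_corput[of "\<lambda>n. v n x" N K, OF v1 N K(1)] by (simp add: W_def v_def multiple_average_def)
  qed
  also have "\<dots> = 8 * (real K / real N)\<^sup>2 + 2 / (real K)\<^sup>2 * (\<Sum>h=1..K. \<Sum>h'=1..K. Re (\<integral>x. W h h' x \<partial>M))"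
    using intW by (simp add: prob_space)
  also have "\<dots> \<le> 8 * (real K / real N)\<^sup>2 + 2 / (real K)\<^sup>2 * (\<Sum>h=1..K. \<Sum>h'=1..K. c (nat \<bar>int h - int h'\<bar>))"
    using Wc by (intro add_left_mono mult_left_mono sum_mono) auto
  also have "\<dots> \<le> 8 * (real K / real N)\<^sup>2 + 2 / (real K)\<^sup>2 * (real K * (c 0 + 2 * (\<Sum>d=1..K. c d)))"
    using c by (intro add_left_mono mult_left_mono sum_abs_diff_le) auto
  also have "\<dots> = 8 * (real K / real N)\<^sup>2 + 2 / real K + 4 / real K * (\<Sum>d=1..K. c d)"
    using K by (simp add: c_def power2_eq_square field_simps)
  also have "(\<Sum>d=1..K. c d) = (\<Sum>d=1..K. y d) + 2 * (real K)\<^sup>2 / real N"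
    by (simp add: c_def sum.distrib power2_eq_square)
  also have "8 * (real K / real N)\<^sup>2 + 2 / real K + 4 / real K * ((\<Sum>d=1..K. y d) + 2 * (real K)\<^sup>2 / real N)
    \<le> 18 / real K + 4 / real K * (\<Sum>d=1..K. y d)"
  proof -
    have q: "(real K)\<^sup>2 / real N \<le> 1"
      using K N by (simp flip: of_nat_power)
    have "(real K / real N)\<^sup>2 = ((real K)\<^sup>2 / real N) * (1 / real N)"
      by (simp add: power2_eq_square)
    also have "\<dots> \<le> 1 * (1 / real K)"
      using q KN K by (intro mult_mono) (auto intro: divide_left_mono)
    finally have "8 * (real K / real N)\<^sup>2 \<le> 8 / real K" by simp
    moreover have "4 / real K * (2 * (real K)\<^sup>2 / real N) \<le> 8 / real K"
      using mult_left_mono[OF q, of "8 / real K"] by simp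
    ultimately show ?thesis by (simp add: distrib_left)
  qed
  finally show ?thesis unfolding y_def .
qed

end

subsection \<open>The induction\<close>

text \<open>The van der Corput step yields only shifts divisible by \<open>\<alpha>\<close>, while a
  box average runs over all shifts up to \<open>H\<close>; nonnegativity permits the
  completion.\<close>

lemma sum_multiples_le:
  fixes G :: "nat \<Rightarrow> real"
  assumes "\<alpha> > 0" "\<alpha> * K \<le> H" "\<And>e. G e \<ge> 0"
  shows "(\<Sum>d=1..K. G (\<alpha> * d)) \<le> (\<Sum>e=1..H. G e)"
proof -
  have "(\<Sum>d=1..K. G (\<alpha> * d)) = (\<Sum>e\<in>(*) \<alpha> ` {1..K}. G e)"
    using assms(1) by (subst sum.reindex) (auto simp: inj_on_def)
  also have "\<dots> \<le> (\<Sum>e=1..H. G e)"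
  proof (rule sum_mono2)
    show "(*) \<alpha> ` {1..K} \<subseteq> {1..H}"
    proof
      fix e assume "e \<in> (*) \<alpha> ` {1..K}"
      then obtain d where d: "e = \<alpha> * d" "d \<in> {1..K}" by blast
      then have "e \<le> \<alpha> * K" by simp
      then have "e \<le> H" using assms(2) by (rule order_trans)
      then show "e \<in> {1..H}" using d assms(1) by simp
    qed
  qed (use assms in auto)
  finally show ?thesis .
qed

lemma le_powr_inverse:
  fixes x z :: real
  assumes "x \<ge> 0" "p > 0" "x ^ p \<le> z"
  shows "x \<le> z powr (1 / real p)"
proof (cases "x = 0")
  case False
  with assms have "x = (x ^ p) powr (1 / real p)"
    by (simp add: powr_powr flip: powr_realpow)
  also have "\<dots> \<le> z powr (1 / real p)"
    using assms by (intro powr_mono2) auto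
  finally show ?thesis .
qed simp

lemma powr_add_le:
  fixes x y :: real
  assumes "x \<ge> 0" "y \<ge> 0" "\<theta> \<ge> 0"
  shows "(x + y) powr \<theta> \<le> 2 powr \<theta> * (x powr \<theta> + y powr \<theta>)"
proof -
  have "(x + y) powr \<theta> \<le> (2 * max x y) powr \<theta>"
    using assms by (intro powr_mono2) auto
  also have "\<dots> = 2 powr \<theta> * max x y powr \<theta>"
    using assms by (simp add: powr_mult)
  also have "max x y powr \<theta> \<le> x powr \<theta> + y powr \<theta>"
    by (auto simp: max_def)
  finally show ?thesis by simp
qed

context invertible_sys
begin

text \<open>Van der Corput bounds \<open>A\<^sup>2\<close> by a mean of norms for derivatives of
  \<open>f\<close>. Jensen's inequality with exponent \<open>2 ^ k\<close> makes the bound for the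
  exponent differences applicable, and \<open>box_average_Suc\<close> reassembles the box
  averages.\<close>

lemma power_bound_Suc:
  assumes a: "a 1 > 0" and C: "C \<ge> 0" and pb: "power_bound k (\<lambda>j. a j - a (k + 3)) C"
  shows "\<exists>C'\<ge>0. power_bound (Suc k) a C'"
proof -
  define \<alpha> where "\<alpha> = nat (a 1)"
  have \<alpha>: "a 1 = int \<alpha>" "\<alpha> > 0" using a by (auto simp: \<alpha>_def)
  define p :: nat where "p = 2 ^ k"
  have p: "p \<ge> 1" by (simp add: p_def)
  \<comment> \<open>The summands serve, in order, the case \<open>H < \<alpha>\<close>, the term
    \<open>18 / K\<close> through \<open>2 ^ p * 18 ^ p = 36 ^ p\<close>, and the assumed bound
    through \<open>2 ^ p * 4 ^ p = 8 ^ p\<close>.\<close>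
  define C' where "C' = \<alpha> + 36 ^ p * (2 * \<alpha>) + 8 ^ p * C * (1 + 2 * \<alpha>)"
  have C': "C' \<ge> 0" "C' \<ge> \<alpha>" using C by (auto simp: C'_def)
  have "power_bound (Suc k) a C'"
    unfolding power_bound_def
  proof (intro allI impI)
    fix f N assume f: "bounded_family f" and N: "N \<ge> (1::nat)"
    define H where "H = isqrt N"
    define A where "A = L1_norm M (multiple_average M T (Suc k + 2) a f N)"
    define Y where "Y = box_average (Suc k) (f 1) N"
    have Y: "Y \<ge> 0" unfolding Y_def by (rule box_average_nonneg)
    have H: "H \<ge> 1" unfolding H_def by (rule isqrt_pos[OF N])
    have A: "0 \<le> A" "A \<le> 1"
      unfolding A_def using norm_multiple_average_le_1[OF f] by (auto intro: L1_norm_nonneg L1_norm_le_1)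
    have "A ^ (2 ^ Suc k) \<le> C' * (1 / real H + Y)"
    proof (cases "H < \<alpha>")
      case True
      \<comment> \<open>No positive \<open>K\<close> with \<open>\<alpha> * K \<le> H\<close> exists
        here, but the trivial bound suffices because \<open>C' \<ge> \<alpha> > H\<close>.\<close>
      have "A ^ (2 ^ Suc k) \<le> 1" using A by (rule power_le_one)
      also have "1 \<le> C' * (1 / real H)"
        using True C' H by (simp add: le_divide_eq)
      also have "\<dots> \<le> C' * (1 / real H + Y)"
        using C' Y by (intro mult_left_mono) auto
      finally show ?thesis .
    next
      case False
      \<comment> \<open>With this choice the shifts \<open>\<alpha> * d\<close>,
        \<open>d \<le> K\<close>, stay below \<open>H\<close>, while
        \<open>H / K \<le> 2 * \<alpha>\<close> means that completing the sum costs only a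
        constant.\<close>
      define K where "K = H div \<alpha>"
      have K: "K \<ge> 1" using False \<alpha> by (simp add: K_def div_greater_zero_iff Suc_le_eq)
      have "H < \<alpha> * (K + 1)" using dividend_less_times_div[OF \<alpha>(2)] by (simp add: K_def)
      also have "\<dots> \<le> \<alpha> * (2 * K)" using K by (intro mult_le_mono2) simp
      finally have "H \<le> 2 * \<alpha> * K" by simp
      then have "real H \<le> real (2 * \<alpha> * K)" by (simp only: of_nat_le_iff)
      then have HK: "real H / real K \<le> 2 * \<alpha>" using K by (simp add: divide_le_eq)
      then have KH: "1 / real K \<le> 2 * \<alpha> * (1 / real H)" using K H by (simp add: field_simps)
      have \<alpha>K: "\<alpha> * K \<le> H" by (simp add: K_def)
      have "K \<le> H" by (simp add: K_def)
      then have "real (K\<^sup>2) \<le> (real H)\<^sup>2" by (simp add: power_mono)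
      also have "\<dots> \<le> real N" unfolding H_def by (rule isqrt_power2_le)
      finally have KN: "K\<^sup>2 \<le> N" by (simp only: of_nat_le_iff)
      define g where "g d = multiplicative_derivative a d f" for d
      define y where "y d = L1_norm M (multiple_average M T (k + 2) (\<lambda>j. a j - a (k + 3)) (g d) N)" for d
      define G where "G e = box_average k (\<lambda>x. f 1 x * cnj (f 1 ((T ^^ e) x))) N" for e
      have y0: "y d \<ge> 0" for d unfolding y_def by (rule L1_norm_nonneg)
      have G0: "G e \<ge> 0" for e unfolding G_def by (rule box_average_nonneg)
      have yG: "y d ^ p \<le> C * (1 / real H + G (\<alpha> * d))" for d
      proof -
        have "g d 1 = (\<lambda>x. f 1 x * cnj (f 1 ((T ^^ (\<alpha> * d)) x)))"
          unfolding g_def multiplicative_derivative_def[abs_def] \<alpha>(1) of_nat_mult[symmetric] U_of_nat ..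
        moreover have "y d ^ p \<le> C * (1 / real H + box_average k (g d 1) N)"
          using pb bounded_family_derivative[OF f, of a d] N
          unfolding power_bound_def y_def g_def H_def p_def by blast
        ultimately show ?thesis by (simp only: G_def)
      qed
      have "(\<Sum>d=1..K. y d ^ p) \<le> (\<Sum>d=1..K. C * (1 / real H + G (\<alpha> * d)))"
        by (intro sum_mono yG)
      also have "\<dots> = C * (real K / real H + (\<Sum>d=1..K. G (\<alpha> * d)))"
        by (simp add: sum.distrib flip: sum_distrib_left)
      also have "\<dots> \<le> C * (real K / real H + (\<Sum>e=1..H. G e))"
        using C \<alpha> \<alpha>K G0 by (intro mult_left_mono add_left_mono sum_multiples_le) auto
      also have "(\<Sum>e=1..H. G e) = H * Y"
        unfolding Y_def box_average_Suc G_def H_def using N isqrt_pos[OF N] by simp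
      finally have "(\<Sum>d=1..K. y d ^ p) / K \<le> C * (real K / real H + H * Y) / K"
        by (rule divide_right_mono) simp
      also have "\<dots> = C * (1 / real H + (real H / real K) * Y)"
        using K by (simp add: field_simps)
      also have "\<dots> \<le> C * (1 / real H + (2 * \<alpha>) * Y)"
        using C Y HK by (intro mult_left_mono add_left_mono mult_right_mono) auto
      finally have sumy: "(\<Sum>d=1..K. y d ^ p) / K \<le> C * (1 / real H + (2 * \<alpha>) * Y)" .
      have "A\<^sup>2 \<le> 18 / real K + 4 / real K * (\<Sum>d=1..K. y d)"
        using van_der_corput_average[OF f K KN, of "k + 2" a]
        by (simp add: A_def y_def g_def numeral_3_eq_3)
      also have "\<dots> = (\<Sum>d=1..K. 18 / real K + 4 * y d) / card {1..K}"
        using K by (simp add: sum.distrib add_divide_distrib flip: sum_distrib_left)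
      finally have "(A\<^sup>2) ^ p \<le> ((\<Sum>d=1..K. 18 / real K + 4 * y d) / card {1..K}) ^ p"
        by (rule power_mono) simp
      also have "\<dots> \<le> (\<Sum>d=1..K. (18 / real K + 4 * y d) ^ p) / card {1..K}"
        unfolding p_def using y0 K by (intro mean_power_le_mean_of_powers) auto
      also have "\<dots> \<le> (\<Sum>d=1..K. 2 ^ p * ((18 / real K) ^ p + (4 * y d) ^ p)) / card {1..K}"
        using y0 by (intro divide_right_mono sum_mono power_add_le) auto
      also have "\<dots> = 2 ^ p * (18 / real K) ^ p + 2 ^ p * 4 ^ p * ((\<Sum>d=1..K. y d ^ p) / K)"
        using K by (simp add: power_mult_distrib sum.distrib distrib_left add_divide_distrib mult.assoc flip: sum_distrib_left)
      also have "\<dots> = 36 ^ p * (1 / real K) ^ p + 8 ^ p * ((\<Sum>d=1..K. y d ^ p) / K)"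
        by (simp add: power_divide flip: power_mult_distrib)
      also have "\<dots> \<le> 36 ^ p * (2 * \<alpha> * (1 / real H)) + 8 ^ p * (C * (1 / real H + (2 * \<alpha>) * Y))"
      proof -
        \<comment> \<open>The higher power is given away, since the target error is only
          \<open>1 / H\<close>.\<close>
        have "(1 / real K) ^ p \<le> (1 / real K) ^ 1"
          using p K by (intro power_decreasing) auto
        with KH have "(1 / real K) ^ p \<le> 2 * \<alpha> * (1 / real H)" by simp
        with sumy show ?thesis by (intro add_mono mult_left_mono) auto
      qed
      also have "\<dots> \<le> C' * (1 / real H + Y)"
      proof -
        have "8 ^ p * (C * (1 / real H + (2 * \<alpha>) * Y)) \<le> 8 ^ p * (C * ((1 + 2 * \<alpha>) * (1 / real H + Y)))"
          using C Y by (intro mult_left_mono) (auto simp: algebra_simps)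
        moreover have "36 ^ p * (2 * \<alpha> * (1 / real H)) \<le> (\<alpha> + 36 ^ p * (2 * \<alpha>)) * (1 / real H + Y)"
          using Y by (simp add: algebra_simps)
        ultimately show ?thesis unfolding C'_def by (simp add: algebra_simps)
      qed
      finally show ?thesis by (simp add: p_def power_mult[symmetric])
    qed
    then show "L1_norm M (multiple_average M T (Suc k + 2) a f N) ^ 2 ^ Suc k
      \<le> C' * (1 / real (isqrt N) + box_average (Suc k) (f 1) N)"
      by (simp only: A_def H_def Y_def)
  qed
  with C' show ?thesis by blast
qed

text \<open>Distinctness of the exponents makes the differences \<open>a j - a (k + 3)\<close>
  distinct and nonzero, so the hypotheses are inherited. The sign of the first difference is not
  controlled, hence the normalisation by \<open>power_bound_uminus\<close> at each stage.\<close>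

lemma power_bound_exists:
  assumes "inj_on a {1..k + 2}" "\<forall>j\<in>{1..k + 2}. a j \<noteq> 0"
  shows "\<exists>C\<ge>0. power_bound k a C"
  using assms
proof (induction k arbitrary: a)
  case 0
  have *: "\<exists>C\<ge>0. power_bound 0 a C" if "a 1 > 0" "a 2 \<noteq> 0" "a 1 \<noteq> a 2" for a
    using power_bound_0[OF that] that(1) by (intro exI[of _ "6 * \<bar>real_of_int (a 2)\<bar> + 2 * real_of_int (a 1)"]) auto
  have a: "a 1 \<noteq> 0" "a 2 \<noteq> 0" "a 1 \<noteq> a 2"
    using inj_onD[OF 0(1), of 1 2] 0(2) by auto
  show ?case
  proof (cases "a 1 > 0")
    case True
    then show ?thesis using *[of a] a by simp
  next
    case False
    then show ?thesis using *[of "\<lambda>j. - a j"] a power_bound_uminus[of 0 a] by auto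
  qed
next
  case (Suc k)
  have *: "\<exists>C\<ge>0. power_bound (Suc k) a C" if "a 1 > 0" "inj_on a {1..Suc k + 2}" for a
  proof -
    have ne: "a i \<noteq> a j" if "i \<in> {1..k+3}" "j \<in> {1..k+3}" "i \<noteq> j" for i j
      using \<open>inj_on a {1..Suc k + 2}\<close> that by (auto simp: inj_on_def numeral_eq_Suc)
    have "inj_on (\<lambda>j. a j - a (k + 3)) {1..k + 2}"
      using ne by (intro inj_onI) force
    moreover have "\<forall>j\<in>{1..k + 2}. a j - a (k + 3) \<noteq> 0"
      using ne by force
    ultimately obtain C where "C \<ge> 0" "power_bound k (\<lambda>j. a j - a (k + 3)) C"
      using Suc.IH[of "\<lambda>j. a j - a (k + 3)"] by auto
    then show ?thesis using power_bound_Suc[of a C k] that by blast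
  qed
  show ?case
  proof (cases "a 1 > 0")
    case True
    then show ?thesis using * Suc.prems by simp
  next
    case False
    moreover have "a 1 \<noteq> 0" using Suc.prems by simp
    ultimately have "- a 1 > 0" by simp
    moreover have "inj_on (\<lambda>j. - a j) {1..Suc k + 2}"
      using Suc.prems(1) by (simp add: inj_on_def)
    ultimately obtain C where "C \<ge> 0" "power_bound (Suc k) (\<lambda>j. - a j) C"
      using *[of "\<lambda>j. - a j"] by blast
    then show ?thesis using power_bound_uminus by blast
  qed
qed

section \<open>Essentially bounded functions and extraction of the root\<close>

lemma L1_norm_cong_AE:
  fixes g g' :: "'a \<Rightarrow> 'b::{banach, second_countable_topology}"
  assumes [measurable]: "g \<in> borel_measurable M" "g' \<in> borel_measurable M" and "AE x in M. g x = g' x"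
  shows "L1_norm M g = L1_norm M g'"
  unfolding L1_norm_def
proof (rule integral_cong_AE)
  show "AE x in M. norm (g x) = norm (g' x)" using assms(3) by eventually_elim simp
qed measurable

text \<open>Only countably many translates occur, and each pulls null sets back to null sets, so the
  functions agree at all these translates of almost every point.\<close>

lemma L1_norm_multiple_average_cong_AE:
  assumes [measurable]: "\<And>j. j \<in> {1..J} \<Longrightarrow> f j \<in> borel_measurable M" "\<And>j. j \<in> {1..J} \<Longrightarrow> f' j \<in> borel_measurable M"
    and eq: "\<And>j. j \<in> {1..J} \<Longrightarrow> AE x in M. f j x = f' j x"
  shows "L1_norm M (multiple_average M T J a f N) = L1_norm M (multiple_average M T J a f' N)"
proof (intro L1_norm_cong_AE multiple_average_measurable)
  have "AE x in M. \<forall>n. \<forall>j\<in>{1..J}. f j (U (a j * int n) x) = f' j (U (a j * int n) x)"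
    unfolding AE_all_countable AE_ball_countable[OF countable_finite[OF finite_atLeastAtMost]]
    using AE_U[OF eq] by blast
  then show "AE x in M. multiple_average M T J a f N x = multiple_average M T J a f' N x"
    by eventually_elim (simp add: multiple_average_def)
qed (use assms in auto)

text \<open>The cube products and the supremum over \<open>t\<close> use only the values of
  \<open>f\<close> on the forward orbit of the point, so one null set serves all
  \<open>t\<close>.\<close>

lemma box_average_cong_AE:
  assumes [measurable]: "f \<in> borel_measurable M" "f' \<in> borel_measurable M" and eq: "AE x in M. f x = f' x"
  shows "box_average k f N = box_average k f' N"
proof -
  have "AE x in M. \<forall>n. f ((T ^^ n) x) = f' ((T ^^ n) x)"
    unfolding AE_all_countable using AE_U[OF eq, of "int n" for n] by (simp add: U_of_nat)
  then have "AE x in M. sup_twisted_average T (cube_product T k h f) N x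
      = sup_twisted_average T (cube_product T k h f') N x" for h
  proof eventually_elim
    case (elim x)
    have "f ((T ^^ m) ((T ^^ n) x)) = f' ((T ^^ m) ((T ^^ n) x))" for m n
      using elim[rule_format, of "m + n"] by (simp add: funpow_add)
    then show ?case
      by (intro sup_twisted_average_cong) (simp add: cube_product_def)
  qed
  then have "L1_norm M (sup_twisted_average T (cube_product T k h f) N)
      = L1_norm M (sup_twisted_average T (cube_product T k h f') N)" for h
    by (intro L1_norm_cong_AE) measurable
  then show ?thesis by (simp add: box_average_def)
qed

text \<open>The power bound is applied after a change on null sets; taking the root of order
  \<open>2 ^ k\<close> then separates the two error terms.\<close>

lemma multiple_average_bound:
  assumes "inj_on a {1..k + 2}" "\<forall>j\<in>{1..k + 2}. a j \<noteq> 0"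
  shows "\<exists>C>0. \<forall>f. (\<forall>j\<in>{1..k + 2}. f j \<in> borel_measurable M \<and> (AE x in M. norm (f j x) \<le> 1)) \<longrightarrow>
    (\<forall>N\<ge>1. L1_norm M (multiple_average M T (k + 2) a f N)
      \<le> C * (1 / real (isqrt N) powr (1 / 2 ^ k) + box_average k (f 1) N powr (1 / 2 ^ k)))"
proof -
  obtain C where C: "C \<ge> 0" "power_bound k a C" using power_bound_exists[OF assms] by blast
  define \<theta> :: real where "\<theta> = 1 / 2 ^ k"
  have \<theta>: "\<theta> \<ge> 0" by (simp add: \<theta>_def)
  \<comment> \<open>The summand \<open>1\<close> keeps the constant positive when
    \<open>C = 0\<close>.\<close>
  define C' where "C' = C powr \<theta> * 2 powr \<theta> + 1"
  have C': "C' > 0" "C' \<ge> C powr \<theta> * 2 powr \<theta>" by (auto simp: C'_def add_nonneg_pos)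
  have "L1_norm M (multiple_average M T (k + 2) a f N)
      \<le> C' * (1 / real (isqrt N) powr \<theta> + box_average k (f 1) N powr \<theta>)"
    if f: "\<And>j. j \<in> {1..k + 2} \<Longrightarrow> f j \<in> borel_measurable M"
      "\<And>j. j \<in> {1..k + 2} \<Longrightarrow> AE x in M. norm (f j x) \<le> 1" and N: "N \<ge> 1" for f N
  proof -
    \<comment> \<open>Setting the functions to \<open>0\<close> where they exceed the bound, and at
      indices out of range, makes the family bounded everywhere.\<close>
    define f' where "f' j x = (if j \<in> {1..k + 2} \<and> norm (f j x) \<le> 1 then f j x else 0)" for j x
    have f'm: "f' j \<in> borel_measurable M" for j
    proof (cases "j \<in> {1..k + 2}")
      case True
      then have [measurable]: "f j \<in> borel_measurable M" by (rule f)
      show ?thesis unfolding f'_def[abs_def] by measurable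
    next
      case False
      then have "f' j = (\<lambda>x. 0)" by (intro ext) (auto simp: f'_def)
      then show ?thesis by simp
    qed
    then have bf: "bounded_family f'"
      by (auto simp: bounded_family_def f'_def)
    have eq: "AE x in M. f j x = f' j x" if "j \<in> {1..k + 2}" for j
      using f(2)[OF that] by eventually_elim (use that in \<open>simp add: f'_def\<close>)
    have "L1_norm M (multiple_average M T (k + 2) a f N) = L1_norm M (multiple_average M T (k + 2) a f' N)"
      using f f'm eq by (intro L1_norm_multiple_average_cong_AE) auto
    also have "\<dots> \<le> (C * (1 / real (isqrt N) + box_average k (f' 1) N)) powr (1 / real (2 ^ k))"
      using C(2) bf N by (intro le_powr_inverse L1_norm_nonneg) (auto simp: power_bound_def)
    also have "\<dots> = C powr \<theta> * (1 / real (isqrt N) + box_average k (f' 1) N) powr \<theta>"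
      using C box_average_nonneg by (simp add: \<theta>_def powr_mult)
    also have "\<dots> \<le> C powr \<theta> * (2 powr \<theta> * ((1 / real (isqrt N)) powr \<theta> + box_average k (f' 1) N powr \<theta>))"
      using box_average_nonneg \<theta> by (intro mult_left_mono powr_add_le) auto
    also have "\<dots> \<le> C' * ((1 / real (isqrt N)) powr \<theta> + box_average k (f' 1) N powr \<theta>)"
      unfolding mult.assoc[symmetric] using C' by (intro mult_right_mono) auto
    also have "box_average k (f' 1) N = box_average k (f 1) N"
      using f f'm eq[of 1] by (intro box_average_cong_AE) auto
    finally show ?thesis by (simp add: powr_divide)
  qed
  with C'(1) show ?thesis unfolding \<theta>_def by blast
qed

end

lemma Linf_norm_le_1D:
  assumes "f \<in> Linf M" "Linf_norm M f \<le> 1"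
  shows "AE x in M. norm (f x) \<le> 1"
  using esssup_AE[where f = "\<lambda>x. ereal (norm (f x))" and M = M]
proof eventually_elim
  case (elim x)
  then have "ereal (norm (f x)) \<le> 1"
    using assms(2) unfolding Linf_norm_def by (rule order_trans)
  then show ?case by simp
qed

theorem theorem5p6:
  fixes J :: nat and M :: "'a measure" and T :: "'a \<Rightarrow> 'a" and a :: "nat \<Rightarrow> int"
  assumes "J \<ge> 3"
    and "invertible_system M T"
    and "inj_on a {1..J}"
    and "\<forall>j\<in>{1..J}. a j \<noteq> 0"
  shows "\<exists>(C::real) (N0::nat). C > 0 \<and> N0 \<ge> 1 \<and>
    (\<forall>f :: nat \<Rightarrow> 'a \<Rightarrow> complex.
      (\<forall>j\<in>{1..J}. f j \<in> Linf M) \<and> Max ((\<lambda>j. Linf_norm M (f j)) ` {1..J}) \<le> 1 \<longrightarrow>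
      (\<forall>N\<ge>N0.
        L1_norm M (multiple_average M T J a f N)
        \<le> C * (1 / real (isqrt N) powr (1 / 2 ^ (J - 2))
             + (1 / real (isqrt N) ^ (J - 2) *
                 (\<Sum>h\<in>nat_box (isqrt N) (J - 2).
                    L1_norm M (sup_twisted_average T (cube_product T (J - 2) h (f 1)) N)
                      powr (2 / 3)))
               powr (1 / 2 ^ (J - 2)))))"
proof -
  interpret invertible_sys M T by standard fact
  have J: "J - 2 + 2 = J" using assms(1) by simp
  obtain C where C: "C > 0"
    "\<And>f N. (\<forall>j\<in>{1..J}. f j \<in> borel_measurable M \<and> (AE x in M. norm (f j x) \<le> 1)) \<Longrightarrow> N \<ge> 1 \<Longrightarrow>
     L1_norm M (multiple_average M T J a f N)
      \<le> C * (1 / real (isqrt N) powr (1 / 2 ^ (J - 2)) + box_average (J - 2) (f 1) N powr (1 / 2 ^ (J - 2)))"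
    using multiple_average_bound[of a "J - 2"] assms(3,4) unfolding J by blast
  have bounded: "f j \<in> borel_measurable M \<and> (AE x in M. norm (f j x) \<le> 1)"
    if "\<forall>j\<in>{1..J}. f j \<in> Linf M" "Max ((\<lambda>j. Linf_norm M (f j)) ` {1..J}) \<le> 1" "j \<in> {1..J}"
    for f :: "nat \<Rightarrow> 'a \<Rightarrow> complex" and j
  proof -
    have "Linf_norm M (f j) \<le> Max ((\<lambda>j. Linf_norm M (f j)) ` {1..J})"
      using that(3) by (intro Max_ge) auto
    with that have "Linf_norm M (f j) \<le> 1" by (meson order_trans)
    with that show ?thesis by (auto simp: Linf_def intro!: Linf_norm_le_1D)
  qed
  \<comment> \<open>The threshold \<open>1\<close> works: \<open>N \<ge> 1\<close> already makes
    \<open>isqrt N\<close> positive, and small \<open>N\<close> are covered by the constant.\<close>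
  show ?thesis
    using C bounded unfolding box_average_def by (intro exI[of _ C] exI[of _ 1]) blast
qed

end
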